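(* Let $B$ be a finite direct power of $C_2$, let $\omega\in\Omega$ be an infinite sequence of non-trivial elements of $B^*$, written in syllable form as $\omega=\omega_1^{a_1}\omega_2^{a_2}\dots$, and suppose that $\underline{\dim}(\omega)=n\geq 2$. Then the Hausdorff dimension of the spinal group $G_\omega$ is $$\dim_H G_\omega=\frac12\liminf_{k\to\infty}\left(\frac{\Sigma_k}{2^{s_k}}+\frac1{2^{s_k}}\sum_{i=2}^{n-1}2^{s_{\lambda_i}}\left(2-\frac1{2^{a_{\lambda_i}}}\right)+\frac1{2^{a_k}}\left(1-\frac1{2^{a_{k-1}}}\right)\right),$$ where $s_k=a_1+\dots+a_k$, $\Sigma_k=\sum_{j=1}^k2^{s_{j-1}}a_j$ (with $s_0=0$), and for each $i\in\{2,\dots,n-1\}$, $\lambda_i=\lambda_i(k)$ is the smallest integer such that $$\dim\bigl(\sigma^{s_{\lambda_i(k)}}\omega\bmod (s_k+1-s_{\lambda_i(k)})\bigr)=i$$ (this is defined for all sufficiently large $k$).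
   Context: Tree automorphisms. Let $X=\{0,1\}$ and let $\mathcal T$ be the infinite binary rooted tree, with vertices identified with the set $X^*$ of finite words over $X$. Every $g\in\operatorname{Aut}\mathcal T$ is written $g=\ll g@0,g@1\gg\tau$ with $g@x\in\operatorname{Aut}\mathcal T$ and $\tau\in\operatorname{Sym}(X)\cong C_2\cong\mathbb Z/2\mathbb Z$; it sends $xw$ to the letter $\tau(x)$ followed by the image of $w$ under $g@x$ ($\tau$ is omitted if trivial). For $G\le\operatorname{Aut}\mathcal T$, $\operatorname{Stab}_G(m)$ is the subgroup of elements fixing every vertex of $X^m$, and $(G\bmod m)=G/\operatorname{Stab}_G(m)$. The Hausdorff dimension of a subgroup $G$ is $\dim_HG=\liminf_{m\to\infty}\frac{\log_2|G\bmod m|}{2^m}$. Spinal groups. Let $B$ be a finite direct power of $C_2$, viewed as a vector space over $\mathbb Z/2\mathbb Z$, with dual space $B^*$. $\Omega$ is the set of infinite sequences $\omega=\omega_1\omega_2\dots$ (developed form) of non-trivial elements of $B^*$. Let $a\in\operatorname{Aut}\mathcal T$ be the involution exchanging the two maximal subtrees ($xw\mapsto(1-x)w$), and identify $\mathbb Z/2\mathbb Z$ with $\langle a\rangle$. Each $b\in B$ acts on $\mathcal T$ by $b=\ll\omega_1(b),b@1\gg$ and, recursively, $b@1^k=\ll\omega_{k+1}(b),b@1^{k+1}\gg$. The spinal group $G_\omega$ is the subgroup of $\operatorname{Aut}\mathcal T$ generated by $a$ and (the image of) $B$. Syllables. The syllable form of $\omega$ is $\omega_1^{a_1}\omega_2^{a_2}\dots$,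 where now consecutive $\omega_i,\omega_{i+1}$ are distinct and the $a_i\ge1$ are multiplicities; $s_k=a_1+\dots+a_k$. The shift is $\sigma(\omega_1\omega_2\dots)=\omega_2\omega_3\dots$ (on developed forms). For $m\ge1$, $s^{-1}(m)$ is the number of syllables of the prefix of $\omega$ of length $m-1$, i.e. the integer with $s_{s^{-1}(m)-1}+1<m\le s_{s^{-1}(m)}+1$. For $\omega$ in syllable form, $\dim(\omega\bmod m)$ is the dimension of the span of $\omega_1,\dots,\omega_{s^{-1}(m)}$ (equivalently, of the span of the first $m-1$ terms of the developed form). Finally $\underline{\dim}(\omega)=\liminf_{j\to\infty}\bigl(\lim_{m\to\infty}\dim(\sigma^j\omega\bmod m)\bigr)$. *)

theory Defs
  imports
    "HOL-Analysis.Cartesian_Space"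
    "HOL-Library.Z2"
    "HOL-Library.Function_Algebras"
    "HOL-Library.Sublist"
    "HOL-Library.Extended_Nat"
    "HOL-Library.Extended_Real"
    "HOL-Library.Liminf_Limsup"
    "HOL-Algebra.Generated_Groups"
begin

section \<open>Automorphisms of the infinite binary rooted tree\<close>

text \<open>
  The vertices are the finite words over the alphabet \<open>bit\<close>, the field with two elements, so that
  letters and elements of the symmetric group of the alphabet are both elements of \<open>bit\<close>, the
  latter acting by addition. The descendants of a vertex are the words of which it is a prefix.
\<close>

definition tree_aut :: "(bit list \<Rightarrow> bit list) set" where
  "tree_aut = {g. bij g \<and> (\<forall>u v. prefix (g u) (g v) \<longleftrightarrow> prefix u v)}"

definition AutT :: "(bit list \<Rightarrow> bit list) monoid" where
  "AutT = \<lparr>carrier = tree_aut, mult = (\<circ>), one = id\<rparr>"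

lemma group_AutT: "group AutT"
proof (rule groupI)
  fix g assume "g \<in> carrier AutT"
  then have g: "bij g" "\<And>u v. prefix (g u) (g v) \<longleftrightarrow> prefix u v"
    by (auto simp: AutT_def tree_aut_def)
  have "prefix (inv_into UNIV g u) (inv_into UNIV g v) \<longleftrightarrow> prefix u v" for u v
    using g(2)[of "inv_into UNIV g u" "inv_into UNIV g v"] g(1)
    by (simp add: bij_is_surj surj_f_inv_f)
  then show "\<exists>h\<in>carrier AutT. h \<otimes>\<^bsub>AutT\<^esub> g = \<one>\<^bsub>AutT\<^esub>"
    using g(1) by (intro bexI[of _ "inv_into UNIV g"])
      (auto simp: AutT_def tree_aut_def bij_imp_bij_inv bij_is_inj)
qed (auto simp: AutT_def tree_aut_def bij_comp o_assoc)

text \<open>The automorphism written \<open>\<lless>g0, g1\<ggreater>t\<close>.\<close>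

fun node :: "(bit list \<Rightarrow> bit list) \<Rightarrow> (bit list \<Rightarrow> bit list) \<Rightarrow> bit \<Rightarrow> bit list \<Rightarrow> bit list" where
  "node g0 g1 t [] = []"
| "node g0 g1 t (x # w) = (x + t) # (if x = 0 then g0 w else g1 w)"

definition level_stab :: "(bit list \<Rightarrow> bit list) set \<Rightarrow> nat \<Rightarrow> (bit list \<Rightarrow> bit list) set" where
  "level_stab G m = {g \<in> G. \<forall>w. length w = m \<longrightarrow> g w = w}"

definition quot_mod :: "(bit list \<Rightarrow> bit list) set \<Rightarrow> nat \<Rightarrow> (bit list \<Rightarrow> bit list) set monoid" where
  "quot_mod G m = (AutT\<lparr>carrier := G\<rparr>) Mod (level_stab G m)"

definition hausdorff_dim :: "(bit list \<Rightarrow> bit list) set \<Rightarrow> ereal" where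
  "hausdorff_dim G = liminf (\<lambda>m. ereal (log 2 (real (order (quot_mod G m))) / 2 ^ m))"


section \<open>Spinal groups\<close>

text \<open>
  The finite direct power of the cyclic group of order 2 is \<open>bit ^ 'd\<close>; its dual consists of the
  linear functionals \<open>bit ^ 'd \<Rightarrow> bit\<close>, inside the vector space of all functions.
  Developed sequences are indexed from 0, so \<open>\<omega> i\<close> is the term with number \<open>i + 1\<close>.
\<close>

definition dual :: "(bit ^ 'd \<Rightarrow> bit) set" where
  "dual = {\<phi>. Vector_Spaces.linear (*s) (*) \<phi>}"

definition Omega :: "(nat \<Rightarrow> (bit ^ 'd \<Rightarrow> bit)) set" where
  "Omega = {\<omega>. \<forall>i. \<omega> i \<in> dual \<and> \<omega> i \<noteq> (\<lambda>b. 0)}"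

definition shift :: "(nat \<Rightarrow> 'a) \<Rightarrow> nat \<Rightarrow> 'a" where
  "shift \<omega> = (\<lambda>i. \<omega> (Suc i))"

text \<open>The image of \<open>t\<close> under the identification of the integers modulo 2 with \<open>\<langle>a\<rangle>\<close>.\<close>

definition rooted :: "bit \<Rightarrow> bit list \<Rightarrow> bit list" where
  "rooted t = node id id t"

text \<open>
  The action of \<open>b\<close>. The section \<open>b@1^k\<close> for the sequence \<open>\<omega>\<close> is \<open>directed ((shift ^^ k) \<omega>) b\<close>,
  so the recursion below shifts the sequence; it reads \<open>b = \<lless>\<omega> 0 b, b@1\<ggreater>\<close>, see \<open>directed_node\<close>.
\<close>

fun directed :: "(nat \<Rightarrow> 'b \<Rightarrow> bit) \<Rightarrow> 'b \<Rightarrow> bit list \<Rightarrow> bit list" where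
  "directed \<omega> b [] = []"
| "directed \<omega> b (x # w) = x # (if x = 0 then rooted (\<omega> 0 b) w else directed (shift \<omega>) b w)"

lemma directed_node: "directed \<omega> b = node (rooted (\<omega> 0 b)) (directed (shift \<omega>) b) 0"
proof
  fix w show "directed \<omega> b w = node (rooted (\<omega> 0 b)) (directed (shift \<omega>) b) 0 w"
    by (cases w) simp_all
qed

lemma rooted_in_AutT: "rooted t \<in> carrier AutT"
proof -
  have inv: "rooted t (rooted t w) = w" for w
    by (cases w) (auto simp: rooted_def add.assoc simp flip: mult_2)
  have pre: "prefix u v \<Longrightarrow> prefix (rooted t u) (rooted t v)" for u v
    by (cases u; cases v) (auto simp: rooted_def)
  show ?thesis
    unfolding AutT_def tree_aut_def using inv pre by (auto intro!: o_bij[of "rooted t"]) (metis inv)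
qed

lemma directed_in_AutT: "directed \<omega> b \<in> carrier AutT"
proof -
  have inv0: "rooted t (rooted t w) = w" for t w
    by (cases w) (auto simp: rooted_def add.assoc simp flip: mult_2)
  have pre0: "prefix u v \<Longrightarrow> prefix (rooted t u) (rooted t v)" for t u v
    by (cases u; cases v) (auto simp: rooted_def)
  have inv: "directed \<omega> b (directed \<omega> b w) = w" for \<omega> w
    by (induction w arbitrary: \<omega>) (auto simp: inv0)
  have pre: "prefix u v \<Longrightarrow> prefix (directed \<omega> b u) (directed \<omega> b v)" for \<omega> u v
  proof (induction u arbitrary: \<omega> v)
    case (Cons x u)
    then show ?case by (cases v) (auto simp: pre0)
  qed simp
  show ?thesis
    unfolding AutT_def tree_aut_def
    using inv pre by (auto intro!: o_bij[of "directed \<omega> b"]) (metis inv)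
qed

definition spinal_group :: "(nat \<Rightarrow> (bit ^ 'd \<Rightarrow> bit)) \<Rightarrow> (bit list \<Rightarrow> bit list) set" where
  "spinal_group \<omega> = generate AutT ({rooted 1} \<union> range (directed \<omega>))"

lemma subgroup_spinal_group: "subgroup (spinal_group \<omega>) AutT"
  unfolding spinal_group_def
  by (intro group.generate_is_subgroup[OF group_AutT])
    (use rooted_in_AutT directed_in_AutT in auto)


section \<open>Dimensions and syllables\<close>

definition fun_scale :: "bit \<Rightarrow> ('b \<Rightarrow> bit) \<Rightarrow> 'b \<Rightarrow> bit" where
  "fun_scale c \<phi> = (\<lambda>b. c * \<phi> b)"

interpretation fun_space: vector_space fun_scale
  by unfold_locales (auto simp: fun_scale_def fun_eq_iff algebra_simps)

text \<open>For \<open>m \<ge> 1\<close> this is the dimension of the span of the first \<open>m - 1\<close> terms.\<close>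

definition dim_mod :: "(nat \<Rightarrow> 'b \<Rightarrow> bit) \<Rightarrow> nat \<Rightarrow> nat" where
  "dim_mod \<omega> m = fun_space.dim (fun_space.span (\<omega> ` {..<m - 1}))"

text \<open>The inner limit is that of a sequence of natural numbers, in the discrete topology.\<close>

definition lower_dim :: "(nat \<Rightarrow> 'b \<Rightarrow> bit) \<Rightarrow> enat" where
  "lower_dim \<omega> = liminf (\<lambda>j. enat (lim (\<lambda>m. dim_mod ((shift ^^ j) \<omega>) m)))"

text \<open>Syllables are indexed from 1: \<open>c k\<close> and \<open>a k\<close> matter for \<open>k \<ge> 1\<close> only.\<close>

definition syl_sum :: "(nat \<Rightarrow> nat) \<Rightarrow> nat \<Rightarrow> nat" where
  "syl_sum a k = (\<Sum>j=1..k. a j)"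

definition syllable_form :: "(nat \<Rightarrow> 'a) \<Rightarrow> (nat \<Rightarrow> 'a) \<Rightarrow> (nat \<Rightarrow> nat) \<Rightarrow> bool" where
  "syllable_form \<omega> c a \<longleftrightarrow>
     (\<forall>k\<ge>1. a k \<ge> 1 \<and> c k \<noteq> c (k + 1) \<and> (\<forall>i. syl_sum a (k - 1) \<le> i \<and> i < syl_sum a k \<longrightarrow> \<omega> i = c k))"

definition Sigma_sum :: "(nat \<Rightarrow> nat) \<Rightarrow> nat \<Rightarrow> nat" where
  "Sigma_sum a k = (\<Sum>j=1..k. 2 ^ syl_sum a (j - 1) * a j)"

text \<open>
  The bound \<open>l \<le> k\<close> keeps the second argument of \<open>dim_mod\<close> at least 1.
\<close>

definition lambda_cond :: "(nat \<Rightarrow> 'b \<Rightarrow> bit) \<Rightarrow> (nat \<Rightarrow> nat) \<Rightarrow> nat \<Rightarrow> nat \<Rightarrow> nat \<Rightarrow> bool" where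
  "lambda_cond \<omega> a i k l \<longleftrightarrow>
     l \<le> k \<and> dim_mod ((shift ^^ syl_sum a l) \<omega>) (syl_sum a k + 1 - syl_sum a l) = i"

definition lambda_idx :: "(nat \<Rightarrow> 'b \<Rightarrow> bit) \<Rightarrow> (nat \<Rightarrow> nat) \<Rightarrow> nat \<Rightarrow> nat \<Rightarrow> nat" where
  "lambda_idx \<omega> a i k = (LEAST l. lambda_cond \<omega> a i k l)"

end

theory Submission
  imports Defs "HOL-Analysis.Extended_Real_Limits"
begin

text \<open>
  Let \<open>H\<close> be the spinal group of the shifted sequence and \<open>N\<close> the group of all \<open>g\<close> with
  \<open>\<lless>1, g\<ggreater>\<close> in the given group, all modulo some level. The stabiliser of the first level is
  subdirect in \<open>H \<times> H\<close>, hence of order \<open>\<bar>H\<bar> \<bar>N\<bar>\<close>. Write \<open>\<phi>\<close> for the first term of the sequence.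
  If \<open>\<phi>\<close> is not in the span of the later terms that are visible at the level, then \<open>N = H\<close>. Otherwise
  \<open>H / N\<close> is a dihedral group of order \<open>2 ^ (p + 3)\<close>, generated by \<open>a\<close> and a \<open>b\<close> with \<open>\<phi> b = 1\<close>; here
  \<open>p\<close> is the largest number of further terms equal to \<open>\<phi>\<close> after which \<open>\<phi>\<close> is still in the span of
  the remaining visible ones. The order of \<open>a b\<close> is bounded above because \<open>(a b) ^ (4 * 2 ^ p) = 1\<close> in
  \<open>H\<close> for a suitable \<open>b\<close>, and below by an action on the integers modulo \<open>8 * 2 ^ p\<close>.

  The resulting recursion for the order of the quotient modulo a level is summed along the syllables.
  A syllable whose functional is independent of the later visible ones contributes an extra
  term; these are exactly the \<open>\<lambda>\<^sub>i\<close>, together with the last two syllables, which give the explicit terms,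
  and with boundedly many others, which vanish in the limit. Within one syllable the normalised
  logarithm of the order is non-increasing, so that the limes inferior may be taken along the ends of the syllables.
\<close>

section \<open>Truncated tree automorphisms\<close>

declare add_bit_eq_xor [simp del] mult_bit_eq_and [simp del]

lemma UNIV_bit: "(UNIV :: bit set) = {0, 1}"
  using bit_not_zero_iff by auto

instance bit :: finite
  by standard (metis UNIV_bit finite.emptyI finite.insertI)

lemma bit_add_self [simp]: "x + x = (0::bit)"
  by (cases x) auto

lemma bit_add_eq_0_iff [simp]: "x + y = 0 \<longleftrightarrow> x = (y::bit)"
  by (cases x; cases y) auto

lemma node_comp:
  "node g0 g1 t \<circ> node h0 h1 s =
    node ((if s = 0 then g0 else g1) \<circ> h0) ((if s = 0 then g1 else g0) \<circ> h1) (t + s)"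
proof
  fix w show "(node g0 g1 t \<circ> node h0 h1 s) w =
      node ((if s = 0 then g0 else g1) \<circ> h0) ((if s = 0 then g1 else g0) \<circ> h1) (t + s) w"
    by (cases w; cases s; cases t) auto
qed

lemma node_id: "node id id 0 = id"
proof
  fix w show "node id id 0 w = id w"
    by (cases w) auto
qed

lemma node_eq_iff: "node g0 g1 t = node h0 h1 s \<longleftrightarrow> g0 = h0 \<and> g1 = h1 \<and> t = s"
proof
  assume eq: "node g0 g1 t = node h0 h1 s"
  have "g0 w = h0 w \<and> g1 w = h1 w \<and> t = s" for w
    using fun_cong[OF eq, of "0 # w"] fun_cong[OF eq, of "1 # w"] by simp
  then show "g0 = h0 \<and> g1 = h1 \<and> t = s"
    by auto
qed simp

text \<open>Copying the letters beyond depth \<open>m\<close> keeps a truncation a function on all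
  words, so that the quotient modulo a level is modelled by plain composition and equality.\<close>

definition trunc :: "nat \<Rightarrow> (bit list \<Rightarrow> bit list) \<Rightarrow> bit list \<Rightarrow> bit list" where
  "trunc m g w = g (take m w) @ drop m w"

lemma trunc_id [simp]: "trunc m id = id"
  by (auto simp: trunc_def)

lemma trunc_0: "g [] = [] \<Longrightarrow> trunc 0 g = id"
  by (auto simp: trunc_def)

lemma trunc_Suc_node: "trunc (Suc m) (node g0 g1 t) = node (trunc m g0) (trunc m g1) t"
proof
  fix w show "trunc (Suc m) (node g0 g1 t) w = node (trunc m g0) (trunc m g1) t w"
    by (cases w) (auto simp: trunc_def)
qed

lemma trunc_comp:
  assumes "\<And>w. length (h w) = length w"
  shows "trunc m (g \<circ> h) = trunc m g \<circ> trunc m h"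
proof
  fix w show "trunc m (g \<circ> h) w = (trunc m g \<circ> trunc m h) w"
    by (cases "length w \<le> m") (auto simp: trunc_def assms)
qed


section \<open>Words in the generators and their sections\<close>

text \<open>In a word, \<open>None\<close> stands for the generator \<open>a\<close>.\<close>

fun gen :: "(nat \<Rightarrow> 'b \<Rightarrow> bit) \<Rightarrow> 'b option \<Rightarrow> bit list \<Rightarrow> bit list" where
  "gen \<omega> None = rooted 1"
| "gen \<omega> (Some b) = directed \<omega> b"

fun act :: "(nat \<Rightarrow> 'b \<Rightarrow> bit) \<Rightarrow> 'b option list \<Rightarrow> bit list \<Rightarrow> bit list" where
  "act \<omega> [] = id"
| "act \<omega> (l # w) = gen \<omega> l \<circ> act \<omega> w"

primrec par :: "'b option list \<Rightarrow> bit" where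
  "par [] = 0"
| "par (l # w) = (if l = None then 1 else 0) + par w"

text \<open>Sections of generators are words over the shifted sequence:
  \<open>rooted (\<omega> 0 b)\<close> is the letter \<open>a\<close> or the empty word.\<close>

fun letter_sec :: "(nat \<Rightarrow> 'b \<Rightarrow> bit) \<Rightarrow> bit \<Rightarrow> 'b option \<Rightarrow> 'b option list" where
  "letter_sec \<omega> y None = []"
| "letter_sec \<omega> y (Some b) = (if y = 0 then (if \<omega> 0 b = 1 then [None] else []) else [Some b])"

text \<open>The rightmost letter acts first, so \<open>l\<close> meets the letter \<open>x\<close>
  after \<open>w\<close> has moved it to \<open>x + par w\<close>.\<close>

primrec sec :: "(nat \<Rightarrow> 'b \<Rightarrow> bit) \<Rightarrow> bit \<Rightarrow> 'b option list \<Rightarrow> 'b option list" where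
  "sec \<omega> x [] = []"
| "sec \<omega> x (l # w) = letter_sec \<omega> (x + par w) l @ sec \<omega> x w"

lemma rooted_0 [simp]: "rooted 0 = id"
  by (simp add: rooted_def node_id)

lemma rooted_rooted [simp]: "rooted t \<circ> rooted t = id"
  by (simp add: rooted_def node_comp node_id)

lemma rooted_rooted_apply [simp]: "rooted t (rooted t w) = w"
  using rooted_rooted[of t] by (rule pointfree_idE)

lemma directed_directed [simp]: "directed \<omega> b \<circ> directed \<omega> b = id"
proof
  fix w show "(directed \<omega> b \<circ> directed \<omega> b) w = id w"
    by (induction w arbitrary: \<omega>) auto
qed

lemma gen_gen [simp]: "gen \<omega> l \<circ> gen \<omega> l = id"
  by (cases l) auto

lemma length_rooted [simp]: "length (rooted t w) = length w"
  by (cases w) (auto simp: rooted_def)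

lemma length_directed [simp]: "length (directed \<omega> b w) = length w"
  by (induction w arbitrary: \<omega>) auto

lemma length_gen [simp]: "length (gen \<omega> l w) = length w"
  by (cases l) auto

lemma length_act [simp]: "length (act \<omega> u w) = length w"
  by (induction u arbitrary: w) auto

lemma act_append: "act \<omega> (u @ v) = act \<omega> u \<circ> act \<omega> v"
  by (induction u) (auto simp: o_assoc)

lemma act_rev: "act \<omega> (rev w) \<circ> act \<omega> w = id"
proof (induction w)
  case (Cons l w)
  have "act \<omega> (rev (l # w)) \<circ> act \<omega> (l # w) = act \<omega> (rev w) \<circ> (gen \<omega> l \<circ> gen \<omega> l) \<circ> act \<omega> w"
    by (simp only: rev.simps act_append act.simps comp_id o_assoc)
  also have "\<dots> = id"
    by (simp only: gen_gen comp_id Cons.IH)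
  finally show ?case .
qed simp

lemma par_append [simp]: "par (u @ v) = par u + par v"
  by (induction u) (auto simp: add.assoc)

lemma sec_append: "sec \<omega> x (u @ v) = sec \<omega> (x + par v) u @ sec \<omega> x v"
  by (induction u) (auto simp: ac_simps)

lemma gen_node:
  "gen \<omega> l = node (act (shift \<omega>) (letter_sec \<omega> 0 l)) (act (shift \<omega>) (letter_sec \<omega> 1 l))
    (if l = None then 1 else 0)"
  by (cases l) (auto simp: rooted_def directed_node[of \<omega>] node_id)

lemma act_node:
  "act \<omega> w = node (act (shift \<omega>) (sec \<omega> 0 w)) (act (shift \<omega>) (sec \<omega> 1 w)) (par w)"
proof (induction w)
  case (Cons l w)
  show ?case
    unfolding act.simps gen_node[of \<omega> l] Cons.IH
    by (cases l; cases "par w"; cases "\<omega> 0 (the l)")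
      (simp_all only: node_comp act_append par.simps sec.simps letter_sec.simps option.sel
        act.simps append_Nil comp_id id_comp simp_thms if_True if_False zero_neq_one one_neq_zero
        add_0_left add_0_right bit_add_self gen.simps rooted_0 option.distinct)
qed (simp only: act.simps sec.simps par.simps node_id)

lemma gen_in_AutT: "gen \<omega> l \<in> carrier AutT"
  by (cases l) (simp_all add: rooted_in_AutT directed_in_AutT)

text \<open>The generators are involutions, so their products are already closed under
  inverses.\<close>

lemma generate_eq_range_act: "generate AutT (range (gen \<omega>)) = range (act \<omega>)"
proof
  have inv_gen: "inv\<^bsub>AutT\<^esub> (gen \<omega> l) = gen \<omega> l" for l
  proof (rule group.inv_equality[OF group_AutT])
    show "gen \<omega> l \<otimes>\<^bsub>AutT\<^esub> gen \<omega> l = \<one>\<^bsub>AutT\<^esub>"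
      by (simp add: AutT_def)
  qed (rule gen_in_AutT)+
  show "generate AutT (range (gen \<omega>)) \<subseteq> range (act \<omega>)"
  proof
    fix g assume "g \<in> generate AutT (range (gen \<omega>))"
    then show "g \<in> range (act \<omega>)"
    proof (induction rule: generate.induct)
      case one
      have "\<one>\<^bsub>AutT\<^esub> = act \<omega> []" by (simp add: AutT_def)
      then show ?case by blast
    next
      case (incl h)
      then obtain l where "h = gen \<omega> l" by blast
      then have "h = act \<omega> [l]" by simp
      then show ?case by blast
    next
      case (inv h)
      then obtain l where "h = gen \<omega> l" by blast
      then have "inv\<^bsub>AutT\<^esub> h = act \<omega> [l]" using inv_gen by simp
      then show ?case by blast
    next
      case (eng g h)
      then obtain u v where "g = act \<omega> u" "h = act \<omega> v" by blast
      then have "g \<otimes>\<^bsub>AutT\<^esub> h = act \<omega> (u @ v)" by (simp add: AutT_def act_append)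
      then show ?case by blast
    qed
  qed
  have "act \<omega> w \<in> generate AutT (range (gen \<omega>))" for w
  proof (induction w)
    case Nil
    have "act \<omega> [] = \<one>\<^bsub>AutT\<^esub>" by (simp add: AutT_def)
    then show ?case using generate.one by metis
  next
    case (Cons l w)
    have "act \<omega> (l # w) = gen \<omega> l \<otimes>\<^bsub>AutT\<^esub> act \<omega> w" by (simp add: AutT_def)
    then show ?case
      using generate.eng[OF generate.incl Cons.IH] by (metis rangeI)
  qed
  then show "range (act \<omega>) \<subseteq> generate AutT (range (gen \<omega>))" by auto
qed

lemma spinal_group_eq: "spinal_group \<omega> = range (act \<omega>)"
proof -
  have "{rooted 1} \<union> range (directed \<omega>) = range (gen \<omega>)"
    by (auto simp: image_iff) (metis gen.simps option.exhaust)+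
  then show ?thesis
    using generate_eq_range_act by (simp add: spinal_group_def)
qed


section \<open>Finite levels\<close>

definition lact :: "(nat \<Rightarrow> 'b \<Rightarrow> bit) \<Rightarrow> nat \<Rightarrow> 'b option list \<Rightarrow> bit list \<Rightarrow> bit list" where
  "lact \<omega> m w = trunc m (act \<omega> w)"

lemma lact_Nil [simp]: "lact \<omega> m [] = id"
  by (simp add: lact_def)

lemma lact_append: "lact \<omega> m (u @ v) = lact \<omega> m u \<circ> lact \<omega> m v"
  by (simp add: lact_def act_append trunc_comp)

lemma lact_Cons: "lact \<omega> m (l # v) = lact \<omega> m [l] \<circ> lact \<omega> m v"
  using lact_append[of \<omega> m "[l]" v] by simp

lemma lact_rev: "lact \<omega> m (rev w) \<circ> lact \<omega> m w = id"
  unfolding lact_def by (subst trunc_comp [symmetric]) (auto simp: act_rev)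

lemma lact_rev': "lact \<omega> m w \<circ> lact \<omega> m (rev w) = id"
  using lact_rev[of \<omega> m "rev w"] by simp

lemma lact_0 [simp]: "lact \<omega> 0 w = id"
proof -
  have "act \<omega> w [] = []"
    using length_act[of \<omega> w "[]"] by (simp del: length_act)
  then show ?thesis by (simp add: lact_def trunc_0)
qed

lemma lact_Suc:
  "lact \<omega> (Suc m) w = node (lact (shift \<omega>) m (sec \<omega> 0 w)) (lact (shift \<omega>) m (sec \<omega> 1 w)) (par w)"
  by (simp add: lact_def trunc_Suc_node act_node[of \<omega>])

lemma lact_Suc_eq_iff:
  "lact \<omega> (Suc m) u = lact \<omega> (Suc m) v \<longleftrightarrow>
    lact (shift \<omega>) m (sec \<omega> 0 u) = lact (shift \<omega>) m (sec \<omega> 0 v) \<and>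
    lact (shift \<omega>) m (sec \<omega> 1 u) = lact (shift \<omega>) m (sec \<omega> 1 v) \<and> par u = par v"
  by (simp add: lact_Suc node_eq_iff)

lemma lact_Suc_eq_id_iff:
  "lact \<omega> (Suc m) u = id \<longleftrightarrow>
    lact (shift \<omega>) m (sec \<omega> 0 u) = id \<and> lact (shift \<omega>) m (sec \<omega> 1 u) = id \<and> par u = 0"
  using lact_Suc_eq_iff[of \<omega> m u "[]"] by simp

lemma finite_range_lact: "finite (range (lact \<omega> m))"
proof (induction m arbitrary: \<omega>)
  case (Suc m)
  let ?Q = "range (lact (shift \<omega>) m)"
  have "range (lact \<omega> (Suc m)) \<subseteq> (\<lambda>(g, h, t). node g h t) ` (?Q \<times> ?Q \<times> UNIV)"
    by (force simp: lact_Suc)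
  then show ?case
    by (rule finite_subset) (use Suc in simp)
qed simp

lemma card_image_eq_card_image:
  assumes "\<And>x y. x \<in> A \<Longrightarrow> y \<in> A \<Longrightarrow> f x = f y \<longleftrightarrow> g x = g y"
  shows "card (f ` A) = card (g ` A)"
proof (rule bij_betw_same_card)
  show "bij_betw (\<lambda>y. g (inv_into A f y)) (f ` A) (g ` A)"
  proof (rule bij_betw_imageI)
    show "inj_on (\<lambda>y. g (inv_into A f y)) (f ` A)"
      using assms by (intro inj_onI) (metis inv_into_into f_inv_into_f)
    have "g (inv_into A f (f x)) = g x" if "x \<in> A" for x
      using assms that by (metis f_inv_into_f imageI inv_into_into)
    then show "(\<lambda>y. g (inv_into A f y)) ` f ` A = g ` A"
      by (auto simp: image_iff)
  qed
qed

section \<open>The quotient by a level stabiliser\<close>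

lemma level_stab_spinal_group:
  "level_stab (spinal_group \<omega>) m = {act \<omega> w | w. lact \<omega> m w = id}"
proof -
  have aut: "act \<omega> w \<in> tree_aut" for w
  proof -
    have "spinal_group \<omega> \<subseteq> carrier AutT"
      using subgroup.subset[OF subgroup_spinal_group] .
    then show ?thesis by (auto simp: spinal_group_eq AutT_def)
  qed
  have "(\<forall>v. length v = m \<longrightarrow> act \<omega> w v = v) \<longleftrightarrow> lact \<omega> m w = id" for w
  proof
    assume fix_m: "\<forall>v. length v = m \<longrightarrow> act \<omega> w v = v"
    have short: "act \<omega> w v = v" if "length v \<le> m" for v
    proof -
      \<comment> \<open>The padded word is fixed, and the image of \<open>v\<close> is a prefix of
        it of the same length as \<open>v\<close>.\<close>
      let ?v = "v @ replicate (m - length v) 0"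
      have "prefix (act \<omega> w v) (act \<omega> w ?v)"
        using aut[of w] by (auto simp: tree_aut_def)
      then have "prefix (act \<omega> w v) ?v"
        using fix_m that by simp
      then have "prefix (act \<omega> w v) v"
        by (rule prefix_length_prefix) auto
      then show ?thesis
        using length_act[of \<omega> w v] by (metis append_eq_conv_conj prefixE take_all_iff order_refl)
    qed
    show "lact \<omega> m w = id"
      by (auto simp: lact_def trunc_def short)
  next
    assume "lact \<omega> m w = id"
    then show "\<forall>v. length v = m \<longrightarrow> act \<omega> w v = v"
      by (auto simp: lact_def trunc_def fun_eq_iff) (metis append_Nil2 drop_all order_refl take_all)
  qed
  then show ?thesis
    by (auto simp: level_stab_def spinal_group_eq)
qed

lemma order_quot_mod:
  "order (quot_mod (spinal_group \<omega>) m) = card (range (lact \<omega> m))"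
proof -
  define H where "H = level_stab (spinal_group \<omega>) m"
  define C where "C w = {h \<circ> act \<omega> w | h. h \<in> H}" for w
  have C_eq: "r_coset (AutT\<lparr>carrier := spinal_group \<omega>\<rparr>) H (act \<omega> w) = C w" for w
    by (auto simp: r_coset_def C_def AutT_def)
  have "carrier (quot_mod (spinal_group \<omega>) m) =
      (\<Union>g\<in>range (act \<omega>). {r_coset (AutT\<lparr>carrier := spinal_group \<omega>\<rparr>) H g})"
    by (simp add: quot_mod_def FactGroup_def RCOSETS_def H_def spinal_group_eq)
  also have "\<dots> = range C"
    using C_eq by blast
  finally have "carrier (quot_mod (spinal_group \<omega>) m) = range C" .
  moreover have "C u = C v \<longleftrightarrow> lact \<omega> m u = lact \<omega> m v" for u v
  proof
    assume "C u = C v"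
    have "id \<in> H"
      unfolding H_def level_stab_spinal_group by (auto intro: exI[of _ "[]"])
    then have "act \<omega> u \<in> C u"
      unfolding C_def by (metis (mono_tags, lifting) id_comp mem_Collect_eq)
    then obtain w where "act \<omega> u = act \<omega> w \<circ> act \<omega> v" "lact \<omega> m w = id"
      unfolding \<open>C u = C v\<close> by (auto simp: C_def H_def level_stab_spinal_group)
    then show "lact \<omega> m u = lact \<omega> m v"
      by (metis act_append id_comp lact_append lact_def)
  next
    have sub: "C u \<subseteq> C v" if eq: "lact \<omega> m u = lact \<omega> m v" for u v
    proof
      fix g assume "g \<in> C u"
      then obtain w where w: "g = act \<omega> w \<circ> act \<omega> u" "lact \<omega> m w = id"
        by (auto simp: C_def H_def level_stab_spinal_group)
      let ?w = "w @ u @ rev v"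
      have "lact \<omega> m ?w = id"
        using w eq by (simp add: lact_append lact_rev')
      moreover have "g = act \<omega> ?w \<circ> act \<omega> v"
        using w(1) act_rev[of \<omega> v] by (simp add: act_append comp_assoc)
      ultimately show "g \<in> C v"
        by (auto simp: C_def H_def level_stab_spinal_group)
    qed
    then show "C u = C v" if "lact \<omega> m u = lact \<omega> m v"
      using that by (metis subset_antisym)
  qed
  ultimately show ?thesis
    unfolding order_def using card_image_eq_card_image[of UNIV C "lact \<omega> m"] by simp
qed

section \<open>Functionals\<close>

lemma fun_scale_bit: "fun_scale k f = (if k = 0 then 0 else f)"
  by (cases k) (auto simp: fun_scale_def fun_eq_iff)

text \<open>Over the field with two elements the only multiples of \<open>f\<close> are
  \<open>0\<close> and \<open>f\<close>, and subtraction is addition.\<close>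

lemma span_insert_bit:
  "g \<in> fun_space.span (insert f S) \<longleftrightarrow> g \<in> fun_space.span S \<or> g + f \<in> fun_space.span S"
proof -
  have ex_bit: "(\<exists>k. P k) \<longleftrightarrow> P 0 \<or> P 1" for P :: "bit \<Rightarrow> bool"
    by (metis bit_not_zero_iff)
  have "g - f = g + f"
    by (simp add: fun_eq_iff)
  then show ?thesis
    by (simp only: fun_space.span_insert mem_Collect_eq ex_bit fun_scale_bit diff_zero
        if_True if_False simp_thms one_neq_zero)
qed

text \<open>On inserting \<open>s\<close>, a vector \<open>b\<close> for \<open>\<phi>\<close> may
  have \<open>s b = 1\<close>. Since \<open>\<phi> + s\<close> is also outside the span of
  \<open>S\<close>, there is a vector \<open>c\<close> for it; then \<open>c\<close> or
  \<open>b + c\<close> works.\<close>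

lemma exists_separating_vector:
  fixes \<phi> :: "'b::ab_group_add \<Rightarrow> bit"
  assumes "finite S" "\<And>s. s \<in> S \<Longrightarrow> additive s" "additive \<phi>" "\<phi> \<notin> fun_space.span S"
  shows "\<exists>b. \<phi> b = 1 \<and> (\<forall>s\<in>S. s b = 0)"
  using assms
proof (induction S arbitrary: \<phi>)
  case empty
  then have "\<phi> \<noteq> 0"
    by auto
  then show ?case
    by (auto simp: fun_eq_iff)
next
  case (insert s S)
  have notin: "\<phi> \<notin> fun_space.span S" "\<phi> + s \<notin> fun_space.span S"
    using insert.prems(3) span_insert_bit by blast+
  obtain b where b: "\<phi> b = 1" "\<forall>s\<in>S. s b = 0"
    using insert.IH[of \<phi>] insert.prems notin by auto
  show ?case
  proof (cases "s b = 0")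
    case False
    have "additive (\<phi> + s)"
      using insert.prems(1)[of s] insert.prems(2) by (simp add: additive_def algebra_simps)
    then obtain c where c: "\<phi> c + s c = 1" "\<forall>s\<in>S. s c = 0"
      using insert.IH[OF insert.prems(1) _ notin(2)] by (force simp: plus_fun_def)
    show ?thesis
    proof (cases "s c = 0")
      case True
      then show ?thesis using c by auto
    next
      case nz: False
      have "\<phi> (b + c) = 1" "s (b + c) = 0"
        using b c False nz insert.prems(1)[of s] insert.prems(2) by (auto simp: additive_def)
      moreover have "s' (b + c) = 0" if "s' \<in> S" for s'
        using b c insert.prems(1)[of s'] that by (auto simp: additive_def)
      ultimately show ?thesis by auto
    qed
  qed (use b in auto)
qed


section \<open>Counting letters\<close>

primrec cnt :: "('b \<Rightarrow> bit) \<Rightarrow> 'b option list \<Rightarrow> bit" where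
  "cnt g [] = 0"
| "cnt g (l # w) = (case l of None \<Rightarrow> 0 | Some b \<Rightarrow> g b) + cnt g w"

text \<open>A letter \<open>b\<close> with \<open>par w = y\<close> contributes
  \<open>rooted (\<omega> 0 b)\<close> to the section at \<open>y\<close> and itself to the other
  section.\<close>

primrec cnt_at :: "bit \<Rightarrow> ('b \<Rightarrow> bit) \<Rightarrow> 'b option list \<Rightarrow> bit" where
  "cnt_at y g [] = 0"
| "cnt_at y g (l # w) =
    (case l of None \<Rightarrow> 0 | Some b \<Rightarrow> if par w = y then g b else 0) + cnt_at y g w"

lemma cnt_append [simp]: "cnt g (u @ v) = cnt g u + cnt g v"
  by (induction u) (auto simp: add.assoc)

lemma cnt_eq_cnt_at: "cnt g w = cnt_at 0 g w + cnt_at 1 g w"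
  by (induction w) (auto simp: ac_simps split: option.split)

lemma par_sec: "par (sec \<omega> x w) = cnt_at x (\<omega> 0) w"
  by (induction w) (auto split: option.split)

lemma cnt_sec: "cnt g (sec \<omega> x w) = cnt_at (x + 1) g w"
proof (induction w)
  case (Cons l w)
  have "x + par w = 0 \<longleftrightarrow> par w \<noteq> x + 1"
    by (cases x; cases "par w") auto
  then show ?case
    using Cons by (auto split: option.split)
qed simp

lemma cnt_at_add: "cnt_at y (g + h) w = cnt_at y g w + cnt_at y h w"
  by (induction w) (auto simp: ac_simps split: option.split)

lemma lact_sec_eq_id:
  assumes "lact \<omega> (Suc m) w = id"
  shows "lact (shift \<omega>) m (sec \<omega> x w) = id"
  using assms unfolding lact_Suc_eq_id_iff by (cases x) simp_all

text \<open>The sections are trivial one level down. Their parities count the values of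
  \<open>\<omega> 0\<close>, and every directed letter survives in exactly one of them, so that the
  counts of later terms add up over the two sections.\<close>

lemma cnt_eq_0_if_lact_eq_id:
  assumes "lact \<omega> m w = id" "i < m - 1"
  shows "cnt (\<omega> i) w = 0"
  using assms
proof (induction i arbitrary: \<omega> m w)
  case 0
  have "m = Suc (Suc (m - 2))"
    using 0(2) by simp
  then obtain n where "m = Suc (Suc n)" ..
  then have "par (sec \<omega> 0 w) = 0 \<and> par (sec \<omega> 1 w) = 0"
    using 0(1) by (simp only: lact_Suc_eq_id_iff simp_thms)
  then show ?case
    by (simp add: par_sec cnt_eq_cnt_at)
next
  case (Suc i)
  then obtain n where m: "m = Suc n"
    by (cases m) auto
  have "cnt (shift \<omega> i) (sec \<omega> x w) = 0" for x
    using Suc.IH[OF lact_sec_eq_id[OF Suc.prems(1)[unfolded m]]] Suc.prems(2) m by simp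
  from this[of 0] this[of 1] show ?case
    unfolding cnt_sec by (simp add: cnt_eq_cnt_at shift_def)
qed

lemma cnt_span_eq_0:
  assumes "lact \<omega> m w = id" "g \<in> fun_space.span (\<omega> ` {..<m - 1})"
  shows "cnt g w = 0"
  using assms(2)
proof (induction rule: fun_space.span_induct)
  case base
  have "cnt 0 w = 0"
    by (induction w) (auto split: option.split)
  then show ?case
    by (auto simp: fun_space.subspace_def cnt_eq_cnt_at cnt_at_add fun_scale_bit)
next
  case (step x)
  then show ?case
    using cnt_eq_0_if_lact_eq_id[OF assms(1)] by auto
qed


section \<open>A dihedral image\<close>

text \<open>
  The letter \<open>a\<close> acts on the integers by the reflection at \<open>0\<close>, and a letter \<open>b\<close> with
  \<open>\<phi> b = 1\<close> by the reflection at \<open>1\<close>. This does not factor through the action on the tree, but it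
  does so modulo a power of 2 that depends on the level.
\<close>

primrec dih :: "('b \<Rightarrow> bit) \<Rightarrow> 'b option list \<Rightarrow> int \<Rightarrow> int" where
  "dih \<phi> [] = (\<lambda>x. x)"
| "dih \<phi> (l # w) = (\<lambda>x. case l of None \<Rightarrow> - dih \<phi> w x
    | Some b \<Rightarrow> if \<phi> b = 1 then 2 - dih \<phi> w x else dih \<phi> w x)"

lemma dih_append: "dih \<phi> (u @ v) x = dih \<phi> u (dih \<phi> v x)"
  by (induction u) (auto split: option.split)

lemma dih_affine: "dih \<phi> w x = dih \<phi> w 0 + (if par w + cnt \<phi> w = 0 then x else - x)"
proof (induction w)
  case (Cons l w)
  show ?case
    using Cons by (cases "par w"; cases "cnt \<phi> w") (auto split: option.split)
qed simp

lemma dih_rev: "dih \<phi> w (dih \<phi> (rev w) x) = x"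
proof (induction w arbitrary: x rule: rev_induct)
  case (snoc l w)
  then show ?case
    by (auto simp: dih_append split: option.split)
qed simp

lemma dih_dvd: "k dvd x - y \<Longrightarrow> k dvd dih \<phi> w x - dih \<phi> w y"
  using dih_affine[of \<phi> w x] dih_affine[of \<phi> w y]
  by (auto simp: dvd_diff_commute)

text \<open>
  In the coordinates \<open>1 - 2 * y\<close> and \<open>2 * y - 1\<close> of the odd integers, a word acts through its two
  sections; hence the modulus doubles with every term equal to \<open>\<phi>\<close>.
\<close>

lemma dih_sec:
  assumes "\<omega> 0 = \<phi>"
  shows "dih \<phi> w (if x = 0 then 1 - 2 * y else 2 * y - 1) =
    (if x + par w = 0 then 1 - 2 * dih \<phi> (sec \<omega> x w) y else 2 * dih \<phi> (sec \<omega> x w) y - 1)"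
proof (induction w)
  case (Cons l w)
  show ?case
    using Cons assms by (cases x; cases "par w") (auto split: option.split)
qed simp

text \<open>Where one section has a letter \<open>b\<close> with \<open>\<phi> b = 1\<close>, the
  other has \<open>a\<close>. The map \<open>y \<mapsto> 1 - y\<close> exchanges the centres
  \<open>0\<close> and \<open>1\<close> of their reflections.\<close>

lemma dih_sec_swap:
  assumes "\<omega> 0 = \<phi>"
  shows "dih \<phi> (sec \<omega> (x + 1) w) (1 - y) = 1 - dih \<phi> (sec \<omega> x w) y"
proof (induction w)
  case (Cons l w)
  show ?case
    using Cons assms by (cases x; cases "par w"; cases l) auto
qed simp

text \<open>Moving every \<open>a\<close> to the front turns a letter \<open>b\<close> with
  \<open>\<phi> b = 1\<close> into the reflection at \<open>1\<close> or at \<open>-1\<close>. The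
  product of these two is a translation by 4 or -4, so they commute modulo 8 and only the parities
  of their numbers matter.\<close>

definition dih8 :: "bit \<Rightarrow> bit \<Rightarrow> bit \<Rightarrow> int \<Rightarrow> int" where
  "dih8 t n0 n1 x = (let y = if n1 = 1 then - 2 - x else x; z = if n0 = 1 then 2 - y else y
    in if t = 1 then - z else z)"

lemma dih_mod_8: "8 dvd dih \<phi> w x - dih8 (par w) (cnt_at 0 \<phi> w) (cnt_at 1 \<phi> w) x"
proof (induction w)
  case (Cons l w)
  obtain k where "dih \<phi> w x = dih8 (par w) (cnt_at 0 \<phi> w) (cnt_at 1 \<phi> w) x + 8 * k"
    using Cons by (metis add.commute diff_add_cancel dvd_def)
  then show ?case
    by (cases "par w"; cases "cnt_at 0 \<phi> w"; cases "cnt_at 1 \<phi> w"; cases l;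
        simp add: dih8_def; presburger)
qed (simp add: dih8_def)

lemma image_shift: "shift \<omega> ` {i..<j} = \<omega> ` {Suc i..<Suc j}"
proof -
  have "shift \<omega> ` {i..<j} = \<omega> ` Suc ` {i..<j}"
    by (simp only: shift_def image_image)
  then show ?thesis
    by (simp only: image_Suc_atLeastLessThan)
qed

text \<open>For \<open>p = 0\<close> both counts of \<open>\<phi>\<close> by position vanish,
  because they are additive in the functional and vanish on the visible terms; then
  \<open>dih8\<close> is the identity. Each further term equal to \<open>\<phi>\<close> doubles the
  modulus on the odd integers, and affinity carries this over to all integers.\<close>

lemma dih_dvd_if_lact_eq_id:
  assumes "\<And>i. i < p \<Longrightarrow> \<omega> i = \<phi>" "\<phi> \<in> fun_space.span (\<omega> ` {p..<m - 1})" "\<phi> \<noteq> 0"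
    and "lact \<omega> m w = id"
  shows "8 * 2 ^ p dvd dih \<phi> w x - x"
  using assms
proof (induction p arbitrary: \<omega> m w x)
  case 0
  have "m - 1 \<noteq> 0"
    using 0 by (intro notI) auto
  then have "m = Suc (Suc (m - 2))"
    by simp
  then obtain n where m: "m = Suc (Suc n)" ..
  note w = 0(4)[unfolded m, THEN lact_Suc_eq_id_iff[THEN iffD1]]
  have vis: "\<omega> ` {0..<m - 1} = insert (\<omega> 0) (shift \<omega> ` {..<Suc n - 1})"
    using image_shift[of \<omega> 0 n] by (simp add: m atLeast0LessThan lessThan_Suc_eq_insert_0 image_image shift_def)
  have "cnt_at x \<phi> w = 0" for x
  proof -
    have sec: "lact (shift \<omega>) (Suc n) (sec \<omega> x w) = id" for x
      using 0(4) m lact_sec_eq_id by blast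
    have "cnt_at x g w = 0" if "g \<in> fun_space.span (shift \<omega> ` {..<Suc n - 1})" for g
      using cnt_span_eq_0[OF sec that, of "x + 1"] by (simp add: cnt_sec add.assoc)
    moreover have "cnt_at x (\<omega> 0) w = 0"
      using sec[of x] by (simp add: lact_Suc_eq_id_iff par_sec)
    ultimately show ?thesis
      using 0(2) cnt_at_add[of x \<phi> "\<omega> 0" w] unfolding vis span_insert_bit by auto
  qed
  then show ?case
    using dih_mod_8[of \<phi> w x] w by (simp add: dih8_def)
next
  case (Suc p)
  have "{Suc p..<m - 1} \<noteq> {}"
    using Suc.prems by (intro notI) auto
  then obtain n where m: "m = Suc n" and n: "n = Suc (n - 1)"
    by (cases m) auto
  note w = Suc.prems(4)[unfolded m, THEN lact_Suc_eq_id_iff[THEN iffD1]]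
  have "8 * 2 ^ p dvd dih \<phi> (sec \<omega> 0 w) y - y" for y
  proof (rule Suc.IH)
    show "\<phi> \<in> fun_space.span (shift \<omega> ` {p..<n - 1})"
      using Suc.prems(2) n by (simp add: image_shift m)
    show "shift \<omega> i = \<phi>" if "i < p" for i
      using Suc.prems(1)[of "Suc i"] that by (simp add: shift_def)
  qed (use Suc.prems w in auto)
  then have dvd: "2 * (8 * 2 ^ p) dvd (-2) * (dih \<phi> (sec \<omega> 0 w) y - y)" for y
    by (intro mult_dvd_mono) auto
  have "dih \<phi> w (1 - 2 * y) - (1 - 2 * y) = (-2) * (dih \<phi> (sec \<omega> 0 w) y - y)" for y
    using dih_sec[of \<omega> \<phi> w 0 y] Suc.prems(1)[of 0] w by simp
  then have odd: "8 * 2 ^ Suc p dvd dih \<phi> w (1 - 2 * y) - (1 - 2 * y)" for y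
    using dvd[of y] by (simp only: power_Suc mult.left_commute)
  have "8 * 2 ^ Suc p dvd dih \<phi> w 1 - 1" "8 * 2 ^ Suc p dvd dih \<phi> w (-1) - (-1)"
    using odd[of 0] odd[of 1] by auto
  \<comment> \<open>This excludes slope -1: a map \<open>y \<mapsto> x - y\<close> fixing
    \<open>1\<close> and \<open>-1\<close> would make the modulus, a multiple of 16, divide
    4.\<close>
  moreover have "\<not> (8 * 2 ^ Suc p dvd x + 2 \<and> 8 * 2 ^ Suc p dvd x - 2)" for x :: int
    using dvd_diff[of "8 * 2 ^ Suc p" "x + 2" "x - 2"] dvd_trans[of 16 "8 * 2 ^ Suc p" "4 :: int"]
    by auto
  ultimately have "par w + cnt \<phi> w = 0" "8 * 2 ^ Suc p dvd dih \<phi> w 0"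
    using dih_affine[of \<phi> w 1] dih_affine[of \<phi> w "-1"]
    by (auto simp: add.commute split: if_splits)
  then show ?case
    using dih_affine[of \<phi> w x] by simp
qed

section \<open>Elements supported on one subtree\<close>

lemma sec_rev: "sec \<omega> x (rev w) = rev (sec \<omega> (x + par w) w)"
proof (induction w arbitrary: x)
  case (Cons l w)
  have "rev (letter_sec \<omega> y l) = letter_sec \<omega> y l" for y
    by (cases l) auto
  then show ?case
    using Cons by (cases l; cases "par w") (simp_all add: sec_append add.assoc)
qed simp

lemma par_rev [simp]: "par (rev w) = par w"
  by (induction w) (auto simp: add.commute)

text \<open>If \<open>\<omega> 0 b0 = 1\<close>, then \<open>b0\<close> has section \<open>a\<close>
  at \<open>0\<close>, and the conjugate of \<open>b\<close> by \<open>a\<close> has section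
  \<open>b\<close> there. Substituting these therefore inverts \<open>sec \<omega> 0\<close> from
  the right.\<close>

primrec lift :: "'b \<Rightarrow> 'b option list \<Rightarrow> 'b option list" where
  "lift b0 [] = []"
| "lift b0 (l # w) = (case l of None \<Rightarrow> [Some b0] | Some b \<Rightarrow> [None, Some b, None]) @ lift b0 w"

lemma par_lift [simp]: "par (lift b0 w) = 0"
  by (induction w) (auto split: option.split)

lemma sec_lift: "\<omega> 0 b0 = 1 \<Longrightarrow> sec \<omega> 0 (lift b0 w) = w"
  by (induction w) (auto split: option.split)

lemma exists_sec:
  assumes "\<omega> 0 \<noteq> 0"
  shows "\<exists>w. par w = 0 \<and> sec \<omega> x w = u"
proof -
  obtain b0 where b0: "\<omega> 0 b0 = 1"
    using assms by (auto simp: fun_eq_iff)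
  show ?thesis
  proof (cases "x = 0")
    case True
    then show ?thesis
      using sec_lift[of \<omega> b0, OF b0] by (intro exI[of _ "lift b0 u"]) simp
  next
    case False
    have "sec \<omega> 1 (None # lift b0 u @ [None]) = u"
      by (simp add: sec_append sec_lift[of \<omega> b0, OF b0])
    then show ?thesis
      using False by (intro exI[of _ "None # lift b0 u @ [None]"]) simp
  qed
qed

text \<open>The elements \<open>g\<close> with \<open>\<lless>1, g\<ggreater>\<close> in the group, at a finite level.\<close>

definition rist :: "(nat \<Rightarrow> 'b \<Rightarrow> bit) \<Rightarrow> nat \<Rightarrow> (bit list \<Rightarrow> bit list) set" where
  "rist \<omega> m = {lact (shift \<omega>) m (sec \<omega> 1 w) | w. par w = 0 \<and> lact (shift \<omega>) m (sec \<omega> 0 w) = id}"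

lemma ristI:
  "par w = 0 \<Longrightarrow> lact (shift \<omega>) m (sec \<omega> 0 w) = id \<Longrightarrow> lact (shift \<omega>) m (sec \<omega> 1 w) \<in> rist \<omega> m"
  by (auto simp: rist_def)

lemma rist_subset: "rist \<omega> m \<subseteq> range (lact (shift \<omega>) m)"
  by (auto simp: rist_def)

lemma id_in_rist: "id \<in> rist \<omega> m"
  using ristI[of "[]"] by simp

lemma rist_comp:
  assumes "g \<in> rist \<omega> m" "h \<in> rist \<omega> m"
  shows "g \<circ> h \<in> rist \<omega> m"
proof -
  obtain u v where *: "par u = 0" "lact (shift \<omega>) m (sec \<omega> 0 u) = id" "g = lact (shift \<omega>) m (sec \<omega> 1 u)"
    "par v = 0" "lact (shift \<omega>) m (sec \<omega> 0 v) = id" "h = lact (shift \<omega>) m (sec \<omega> 1 v)"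
    using assms by (auto simp: rist_def)
  then show ?thesis
    using ristI[of "u @ v" \<omega> m] by (simp add: sec_append lact_append)
qed

text \<open>\<open>v\<close> is the section at \<open>1\<close> of an element fixing the first
  level, and conjugation by that element keeps a trivial section at \<open>0\<close>
  trivial.\<close>

lemma rist_conj:
  assumes "\<omega> 0 \<noteq> 0" "g \<in> rist \<omega> m"
  shows "lact (shift \<omega>) m (rev v) \<circ> g \<circ> lact (shift \<omega>) m v \<in> rist \<omega> m"
proof -
  obtain u where u: "par u = 0" "lact (shift \<omega>) m (sec \<omega> 0 u) = id" "g = lact (shift \<omega>) m (sec \<omega> 1 u)"
    using assms by (auto simp: rist_def)
  obtain w where w: "par w = 0" "sec \<omega> 1 w = v"
    using exists_sec assms(1) by blast
  show ?thesis
    using ristI[of "rev w @ u @ w" \<omega> m] u w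
    by (simp add: sec_append lact_append sec_rev lact_rev o_assoc)
qed

lemma letter_in_rist: "\<omega> 0 b = 0 \<Longrightarrow> lact (shift \<omega>) m [Some b] \<in> rist \<omega> m"
  using ristI[of "[Some b]" \<omega> m] by simp

lemma lact_left_cancel: "lact \<omega> m u \<circ> g = lact \<omega> m u \<circ> h \<longleftrightarrow> g = h"
  by (metis comp_assoc id_comp lact_rev)

lemma lact_right_cancel: "g \<circ> lact \<omega> m u = h \<circ> lact \<omega> m u \<longleftrightarrow> g = h"
  by (metis comp_assoc comp_id lact_rev')

lemma card_UNIV_bit: "card (UNIV :: bit set) = 2"
  by (metis UNIV_bit card_2_iff zero_neq_one)

text \<open>The elements fixing the first level with a prescribed section at \<open>0\<close> form
  one coset of those with trivial section there, and every section occurs. The factor 2 counts the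
  top permutation.\<close>

lemma card_range_lact_Suc:
  assumes "\<omega> 0 \<noteq> 0"
  shows "card (range (lact \<omega> (Suc m))) = 2 * card (range (lact (shift \<omega>) m)) * card (rist \<omega> m)"
proof -
  let ?L = "lact (shift \<omega>) m"
  let ?Q = "range ?L"
  have "\<exists>w. par w = 0 \<and> ?L (sec \<omega> 0 w) = g" if "g \<in> ?Q" for g
  proof -
    obtain u where "g = ?L u"
      using \<open>g \<in> ?Q\<close> by blast
    then show ?thesis
      using exists_sec[of \<omega> 0 u] assms by auto
  qed
  then obtain W where W: "\<And>g. g \<in> ?Q \<Longrightarrow> par (W g) = 0 \<and> ?L (sec \<omega> 0 (W g)) = g"
    by metis
  define F where "F = (\<lambda>(g, n, t). node g (?L (sec \<omega> 1 (W g)) \<circ> n) t)"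
  have "bij_betw F (?Q \<times> rist \<omega> m \<times> UNIV) (range (lact \<omega> (Suc m)))"
  proof (rule bij_betw_imageI)
    show "inj_on F (?Q \<times> rist \<omega> m \<times> UNIV)"
      by (auto intro!: inj_onI simp: F_def node_eq_iff lact_left_cancel)
    show "F ` (?Q \<times> rist \<omega> m \<times> UNIV) = range (lact \<omega> (Suc m))"
    proof (intro equalityI subsetI)
      fix f assume "f \<in> F ` (?Q \<times> rist \<omega> m \<times> UNIV)"
      then obtain g w t where *: "g \<in> ?Q" "par w = 0" "?L (sec \<omega> 0 w) = id"
          "f = node g (?L (sec \<omega> 1 (W g)) \<circ> ?L (sec \<omega> 1 w)) t"
        by (auto simp: F_def rist_def)
      define v where "v = (if t = 0 then [] else [None]) @ W g @ w"
      have "lact \<omega> (Suc m) v = f"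
        using * W[of g] by (cases t) (simp_all add: v_def lact_Suc sec_append lact_append node_comp)
      then show "f \<in> range (lact \<omega> (Suc m))"
        by blast
    next
      fix f assume "f \<in> range (lact \<omega> (Suc m))"
      then obtain w where w: "f = lact \<omega> (Suc m) w"
        by blast
      \<comment> \<open>Prepending \<open>a\<close> clears the top permutation and leaves both
        sections unchanged as words.\<close>
      define w' where "w' = (if par w = 0 then [] else [None]) @ w"
      have w': "par w' = 0" "sec \<omega> x w' = sec \<omega> x w" for x
        by (auto simp: w'_def)
      define g where "g = ?L (sec \<omega> 0 w)"
      define v where "v = rev (W g) @ w'"
      have Wg: "par (W g) = 0" "?L (sec \<omega> 0 (W g)) = g"
        using W[of g] by (auto simp: g_def)
      have "?L (sec \<omega> 0 v) = ?L (rev (sec \<omega> 0 (W g))) \<circ> ?L (sec \<omega> 0 (W g))"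
        using Wg(1) w' Wg(2) by (simp add: v_def sec_append sec_rev lact_append g_def)
      then have "?L (sec \<omega> 1 v) \<in> rist \<omega> m"
        using Wg(1) w'(1) by (intro ristI) (simp_all add: v_def lact_rev)
      moreover have "?L (sec \<omega> 1 (W g)) \<circ> ?L (sec \<omega> 1 v) = ?L (sec \<omega> 1 w)"
        using Wg(1) w' by (simp add: v_def sec_append sec_rev lact_append o_assoc lact_rev')
      then have "f = F (g, ?L (sec \<omega> 1 v), par w)"
        by (simp add: F_def w lact_Suc g_def)
      ultimately show "f \<in> F ` (?Q \<times> rist \<omega> m \<times> UNIV)"
        by (auto simp: g_def)
    qed
  qed
  from bij_betw_same_card[OF this] show ?thesis
    by (simp add: card_cartesian_product card_UNIV_bit)
qed

text \<open>The value \<open>\<omega> i b\<close> acts on the letter after the vertex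
  \<open>1^i 0\<close>, so it first shows on words of length \<open>i + 2\<close>; hence the bound
  \<open>i < m - 1\<close>.\<close>

lemma lact_letter_eq_id: "(\<And>i. i < m - 1 \<Longrightarrow> \<omega> i b = 0) \<Longrightarrow> lact \<omega> m [Some b] = id"
proof (induction m arbitrary: \<omega>)
  case (Suc m)
  show ?case
  proof (cases m)
    case (Suc k)
    have "lact (shift \<omega>) m [Some b] = id"
      using Suc.prems Suc by (intro Suc.IH) (auto simp: shift_def)
    then show ?thesis
      unfolding lact_Suc_eq_id_iff using Suc.prems[of 0] Suc by simp
  next
    case 0
    then show ?thesis
      unfolding lact_Suc_eq_id_iff by simp
  qed
qed simp

lemma lact_Some_add:
  fixes b c :: "'b::plus"
  assumes "\<And>i. \<omega> i (b + c) = \<omega> i b + \<omega> i c"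
  shows "lact \<omega> m [Some (b + c)] = lact \<omega> m [Some b, Some c]"
  using assms
proof (induction m arbitrary: \<omega>)
  case (Suc m)
  then have "lact (shift \<omega>) m [Some (b + c)] = lact (shift \<omega>) m [Some b, Some c]"
    by (intro Suc.IH) (simp add: shift_def)
  moreover have "lact (shift \<omega>) m [None, None] = id"
    using lact_rev[of "shift \<omega>" m "[None]"] by (simp flip: lact_append)
  ultimately show ?case
    using Suc.prems by (cases "\<omega> 0 b"; cases "\<omega> 0 c") (simp_all add: lact_Suc_eq_iff)
qed simp

text \<open>A vector \<open>b0\<close> separating \<open>\<omega> 0\<close> from the later visible
  terms acts as \<open>\<lless>a, 1\<ggreater>\<close>. Conjugating it by \<open>a\<close> puts
  \<open>a\<close> into \<open>rist\<close>, and adding it to a \<open>b\<close> with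
  \<open>\<omega> 0 b = 1\<close> kills the section at \<open>0\<close> without changing the one at
  \<open>1\<close>.\<close>

lemma rist_eq_range_if_not_in_span:
  fixes \<omega> :: "nat \<Rightarrow> 'b::ab_group_add \<Rightarrow> bit"
  assumes add: "\<And>i. additive (\<omega> i)" and span: "\<omega> 0 \<notin> fun_space.span (\<omega> ` {1..<m})"
  shows "rist \<omega> m = range (lact (shift \<omega>) m)"
proof -
  have nz: "\<omega> 0 \<noteq> 0"
    using span fun_space.span_zero by metis
  obtain b0 where b0: "\<omega> 0 b0 = 1" "\<And>i. i \<in> {1..<m} \<Longrightarrow> \<omega> i b0 = 0"
    using exists_separating_vector[OF _ _ add span] add by fastforce
  have triv: "lact (shift \<omega>) m [Some b0] = id"
    using b0(2) by (intro lact_letter_eq_id) (auto simp: shift_def)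
  have letter: "lact (shift \<omega>) m [l] \<in> rist \<omega> m" for l
  proof (cases l)
    case None
    then show ?thesis
      using ristI[of "[None, Some b0, None]" \<omega> m] b0(1) triv by simp
  next
    case (Some b)
    show ?thesis
    proof (cases "\<omega> 0 b = 0")
      case False
      then have "\<omega> 0 (b + b0) = 0"
        using additive.add[OF add] b0(1) by simp
      moreover have "lact (shift \<omega>) m [Some (b + b0)] = lact (shift \<omega>) m [Some b]"
        using lact_Some_add[of "shift \<omega>" b b0 m] additive.add[OF add] triv
          lact_append[of "shift \<omega>" m "[Some b]" "[Some b0]"]
        by (simp add: shift_def)
      ultimately show ?thesis
        using letter_in_rist[of \<omega> "b + b0" m] Some by simp
    qed (simp add: Some letter_in_rist)
  qed
  have "lact (shift \<omega>) m u \<in> rist \<omega> m" for u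
  proof (induction u)
    case (Cons l u)
    then show ?case
      by (subst lact_Cons) (rule rist_comp[OF letter])
  qed (simp only: lact_Nil id_in_rist)
  then show ?thesis
    using rist_subset by blast
qed

section \<open>The dihedral quotient\<close>

definition alt :: "'b \<Rightarrow> nat \<Rightarrow> 'b option list" where
  "alt b k = concat (replicate k [None, Some b])"

lemma alt_0 [simp]: "alt b 0 = []"
  by (simp add: alt_def)

lemma alt_Suc: "alt b (Suc k) = [None, Some b] @ alt b k"
  by (simp add: alt_def)

lemma alt_add: "alt b (j + k) = alt b j @ alt b k"
  by (simp add: alt_def replicate_add)

lemma alt_Suc': "alt b (Suc k) = alt b k @ [None, Some b]"
  using alt_add[of b k 1] by (simp add: alt_Suc)

lemma par_alt_double: "par (alt b (2 * k)) = 0"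
  by (induction k) (auto simp: alt_Suc)

lemma sec_alt_double:
  assumes "\<omega> 0 b = 1"
  shows "sec \<omega> 1 (alt b (2 * k)) = alt b k" "sec \<omega> 0 (alt b (2 * k)) = rev (alt b k)"
proof -
  show "sec \<omega> 1 (alt b (2 * k)) = alt b k"
    using assms by (induction k) (auto simp: alt_Suc par_alt_double)
  show "sec \<omega> 0 (alt b (2 * k)) = rev (alt b k)"
  proof (induction k)
    case (Suc k)
    have "sec \<omega> 0 (alt b (2 * Suc k)) = [Some b, None] @ rev (alt b k)"
      using assms Suc by (simp add: alt_Suc par_alt_double)
    then show ?case
      by (simp add: alt_Suc')
  qed simp
qed

text \<open>Taking sections halves the exponent of \<open>a b\<close> as long as \<open>b\<close>
  has value 1. At depth \<open>p\<close>, either the sections of \<open>(a b)^4\<close> are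
  \<open>b b\<close>, or \<open>b\<close> is trivial one level further down and
  \<open>(a b)^2\<close> becomes \<open>a a\<close> there.\<close>

lemma lact_alt_eq_id:
  assumes "\<And>i. i < p \<Longrightarrow> \<omega> i b = 1"
    and "\<omega> p b = 0 \<or> (\<forall>i. p < i \<and> i < m - 1 \<longrightarrow> \<omega> i b = 0)"
  shows "lact \<omega> m (alt b (4 * 2 ^ p)) = id"
  using assms
proof (induction p arbitrary: \<omega> m)
  case 0
  show ?case
  proof (cases m)
    case (Suc n)
    have inv: "lact (shift \<omega>) n [l, l] = id" for l
      using lact_rev[of "shift \<omega>" n "[l]"] by (simp flip: lact_append)
    show ?thesis
    proof (cases "\<omega> 0 b = 0")
      case True
      then show ?thesis
        unfolding Suc lact_Suc_eq_id_iff using inv[of "Some b"] by (simp add: numeral_eq_Suc alt_Suc)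
    next
      case False
      then have "lact (shift \<omega>) n [Some b] = id"
        using 0(2) Suc by (intro lact_letter_eq_id) (auto simp: shift_def)
      then have "lact (shift \<omega>) n ([None] @ [Some b] @ [None] @ [Some b]) = lact (shift \<omega>) n ([None] @ [None])"
        unfolding lact_append by simp
      then have alt2: "lact (shift \<omega>) n (alt b 2) = id"
        using inv[of None] by (simp add: numeral_eq_Suc alt_Suc)
      moreover from this have "lact (shift \<omega>) n (rev (alt b 2)) = id"
        using lact_rev[of "shift \<omega>" n "alt b 2"] by simp
      ultimately show ?thesis
        unfolding Suc lact_Suc_eq_id_iff
        using False sec_alt_double[of \<omega> b 2] par_alt_double[of b 2] by simp
    qed
  qed simp
next
  case (Suc p)
  show ?case
  proof (cases m)
    case (Suc n)
    have "lact (shift \<omega>) n (alt b (4 * 2 ^ p)) = id"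
      using Suc.prems Suc by (intro Suc.IH) (auto simp: shift_def)
    moreover from this have "lact (shift \<omega>) n (rev (alt b (4 * 2 ^ p))) = id"
      using lact_rev[of "shift \<omega>" n "alt b (4 * 2 ^ p)"] by simp
    ultimately show ?thesis
      using Suc.prems(1)[of 0] sec_alt_double[of \<omega> b "4 * 2 ^ p"] par_alt_double[of b "4 * 2 ^ p"]
      unfolding Suc lact_Suc_eq_id_iff by (simp add: mult.left_commute)
  qed simp
qed

lemma dih_alt: "\<phi> b = 1 \<Longrightarrow> dih \<phi> (alt b k) x = x - 2 * int k"
  by (induction k arbitrary: x) (auto simp: alt_Suc)

text \<open>If \<open>\<omega> p\<close> differs from \<open>\<omega> 0\<close>, the two are
  distinct and nonzero, hence independent over the field with two elements; otherwise the later
  terms can be separated from \<open>\<omega> 0\<close>.\<close>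

lemma exists_alternating_letter:
  fixes \<omega> :: "nat \<Rightarrow> 'b::ab_group_add \<Rightarrow> bit"
  assumes add: "\<And>i. additive (\<omega> i)" and nz: "\<And>i. \<omega> i \<noteq> 0"
    and p: "\<omega> p \<noteq> \<omega> 0 \<or> \<omega> 0 \<notin> fun_space.span (\<omega> ` {Suc p..<m})"
  shows "\<exists>b. \<omega> 0 b = 1 \<and> (\<omega> p b = 0 \<or> (\<forall>i. p < i \<and> i < m \<longrightarrow> \<omega> i b = 0))"
proof (cases "\<omega> p = \<omega> 0")
  case True
  then obtain b where "\<omega> 0 b = 1" "\<forall>s\<in>\<omega> ` {Suc p..<m}. s b = 0"
    using exists_separating_vector[of "\<omega> ` {Suc p..<m}" "\<omega> 0"] add p by blast
  then show ?thesis
    by (intro exI[of _ b]) auto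
next
  case False
  have "\<omega> 0 + \<omega> p \<noteq> 0"
    using False by (fastforce simp: fun_eq_iff)
  then have "\<omega> 0 \<notin> fun_space.span {\<omega> p}"
    using nz[of 0] by (simp add: span_insert_bit)
  then show ?thesis
    using exists_separating_vector[of "{\<omega> p}" "\<omega> 0"] add by blast
qed

lemma dih_dvd_if_lact_eq:
  assumes "\<And>i. i < p \<Longrightarrow> \<omega> i = \<phi>" "\<phi> \<in> fun_space.span (\<omega> ` {p..<m - 1})" "\<phi> \<noteq> 0"
    and "lact \<omega> m u = lact \<omega> m v"
  shows "8 * 2 ^ p dvd dih \<phi> u x - dih \<phi> v x"
proof -
  have "lact \<omega> m (rev v @ u) = id"
    using assms(4) by (simp only: lact_append lact_rev)
  from dih_dvd_if_lact_eq_id[OF assms(1-3) this]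
  have "8 * 2 ^ p dvd dih \<phi> (rev v) (dih \<phi> u x) - x"
    by (simp add: dih_append)
  from dih_dvd[OF this, of \<phi> v] show ?thesis
    by (simp add: dih_rev)
qed

text \<open>The elements \<open>(a b)^i a^t\<close> with \<open>i < 4 * 2 ^ p\<close> represent
  every coset of \<open>rist\<close> once. They suffice because this power of \<open>a b\<close> is
  trivial, and they are inequivalent because \<open>dih\<close> is well defined modulo
  \<open>8 * 2 ^ p\<close> and trivial on \<open>rist\<close>.\<close>

lemma card_rist_in_span:
  fixes \<omega> :: "nat \<Rightarrow> 'b::ab_group_add \<Rightarrow> bit"
  assumes add: "\<And>i. additive (\<omega> i)" and nz: "\<And>i. \<omega> i \<noteq> 0"
    and p: "\<And>i. i \<le> p \<Longrightarrow> \<omega> i = \<omega> 0"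
    and span: "\<omega> 0 \<in> fun_space.span (\<omega> ` {Suc p..<m})"
    and max: "\<omega> (Suc p) \<noteq> \<omega> 0 \<or> \<omega> 0 \<notin> fun_space.span (\<omega> ` {Suc (Suc p)..<m})"
  shows "card (range (lact (shift \<omega>) m)) = 8 * 2 ^ p * card (rist \<omega> m)"
proof -
  let ?L = "lact (shift \<omega>) m"
  let ?N = "rist \<omega> m"
  define \<phi> where "\<phi> = \<omega> 0"
  define M :: nat where "M = 4 * 2 ^ p"
  obtain b where b: "\<phi> b = 1" "\<omega> (Suc p) b = 0 \<or> (\<forall>i. Suc p < i \<and> i < m \<longrightarrow> \<omega> i b = 0)"
    using exists_alternating_letter[OF add nz max] by (auto simp: \<phi>_def)
  have LM: "?L (alt b M) = id"
    unfolding M_def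
  proof (rule lact_alt_eq_id)
    show "shift \<omega> i b = 1" if "i < p" for i
      using p[of "Suc i"] that b(1) by (simp add: shift_def \<phi>_def)
    show "shift \<omega> p b = 0 \<or> (\<forall>i. p < i \<and> i < m - 1 \<longrightarrow> shift \<omega> i b = 0)"
      using b(2) by (auto simp: shift_def)
  qed
  have inv: "?L [l] \<circ> ?L [l] = id" for l
    using lact_rev[of "shift \<omega>" m "[l]"] by simp
  define word where "word i t = alt b i @ (if t then [None] else [])" for i t
  have normal_form: "\<exists>i t. \<exists>n\<in>?N. ?L u = ?L (word i t) \<circ> n" for u
  proof (induction u rule: rev_induct)
    case Nil
    have "?L [] = ?L (word 0 False) \<circ> id"
      by (simp add: word_def)
    then show ?case
      using id_in_rist by blast
  next
    case (snoc l u)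
    then obtain i t n where n: "n \<in> ?N" "?L u = ?L (word i t) \<circ> n"
      by blast
    \<comment> \<open>Normality of \<open>rist\<close> lets the new letter move past
      \<open>n\<close> to the word in normal form.\<close>
    define n' where "n' = ?L [l] \<circ> n \<circ> ?L [l]"
    have "n' \<in> ?N"
      using rist_conj[OF nz n(1), of "[l]"] by (simp add: n'_def)
    have "?L (word i t) \<circ> ?L [l] \<circ> n' = ?L (word i t) \<circ> (?L [l] \<circ> ?L [l]) \<circ> n \<circ> ?L [l]"
      by (simp only: n'_def o_assoc)
    also have "\<dots> = ?L (u @ [l])"
      by (simp only: inv comp_id lact_append n(2))
    finally have u: "?L (u @ [l]) = ?L (word i t) \<circ> ?L [l] \<circ> n'"
      by simp
    have "\<exists>j s. \<exists>k\<in>?N. ?L (word i t) \<circ> ?L [l] = ?L (word j s) \<circ> k"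
    proof (cases l)
      case None
      have "?L (word i t) \<circ> ?L [l] = ?L (word i (\<not> t)) \<circ> id"
        using inv[of None] None by (cases t) (simp_all add: word_def lact_append comp_assoc)
      then show ?thesis
        using id_in_rist by blast
    next
      case (Some c)
      show ?thesis
      proof (cases "\<omega> 0 c = 0")
        case True
        then have "?L [l] \<in> ?N"
          by (simp add: Some letter_in_rist)
        then show ?thesis
          by (intro exI bexI[of _ "?L [l]"]) (rule refl)
      next
        case False
        then have "\<omega> 0 (b + c) = 0"
          using b(1) additive.add[OF add] by (simp add: \<phi>_def)
        then have mem: "?L [Some (b + c)] \<in> ?N"
          by (rule letter_in_rist)
        have "?L [Some b] \<circ> ?L [Some (b + c)] = (?L [Some b] \<circ> ?L [Some b]) \<circ> ?L [Some c]"
          using lact_Some_add[of "shift \<omega>" b c m] additive.add[OF add]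
            lact_append[of "shift \<omega>" m "[Some b]" "[Some c]"]
          by (simp add: shift_def o_assoc)
        then have c: "?L [l] = ?L [Some b] \<circ> ?L [Some (b + c)]"
          by (simp add: inv Some)
        obtain j s where "?L (word i t) \<circ> ?L [Some b] = ?L (word j s)"
        proof (cases t)
          case True
          then have "word i t @ [Some b] = word (Suc i) False"
            by (simp add: word_def alt_Suc')
          then show ?thesis
            using that[of "Suc i" False] by (simp only: lact_append[symmetric])
        next
          case False
          \<comment> \<open>Since \<open>(a b)^M\<close> is trivial, a further \<open>b\<close>
            equals \<open>(a b)^(M - 1) a\<close>, which restores the normal form.\<close>
          have "alt b M = (alt b (M - 1) @ [None]) @ [Some b]"
            using alt_Suc'[of b "M - 1"] by (simp add: M_def)
          then have "?L (alt b (M - 1) @ [None]) \<circ> ?L [Some b] = ?L [Some b] \<circ> ?L [Some b]"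
            using LM inv by (metis lact_append)
          then have "?L [Some b] = ?L (alt b (M - 1) @ [None])"
            by (simp only: lact_right_cancel)
          then have "?L (word i t) \<circ> ?L [Some b] = ?L (word (i + (M - 1)) True)"
            using False by (simp add: word_def alt_add lact_append o_assoc)
          then show ?thesis
            by (rule that)
        qed
        then have "?L (word i t) \<circ> ?L [l] = ?L (word j s) \<circ> ?L [Some (b + c)]"
          by (simp only: c o_assoc)
        then show ?thesis
          using mem by (intro exI bexI[of _ "?L [Some (b + c)]"])
      qed
    qed
    then obtain j s k where k: "k \<in> ?N" "?L (word i t) \<circ> ?L [l] = ?L (word j s) \<circ> k"
      by (elim exE bexE) (rule that)
    have "?L (u @ [l]) = ?L (word j s) \<circ> (k \<circ> n')"
      unfolding u k(2) by (rule comp_assoc)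
    moreover have "k \<circ> n' \<in> ?N"
      using k(1) \<open>n' \<in> ?N\<close> by (rule rist_comp)
    ultimately show ?case
      by blast
  qed
  have L_mod: "?L (word (i mod M) t) = ?L (word i t)" for i t
  proof -
    have "?L (alt b (M * k)) = id" for k
      by (induction k) (simp_all add: alt_add lact_append LM)
    then have "?L (alt b (M * (i div M) + i mod M)) = ?L (alt b (i mod M))"
      by (simp only: alt_add lact_append id_comp)
    then show ?thesis
      by (simp add: word_def lact_append)
  qed
  have M_pos: "M > 0"
    by (simp add: M_def)
  define F where "F = (\<lambda>(i, t, n :: bit list \<Rightarrow> bit list). ?L (word i t) \<circ> n)"
  have "bij_betw F ({..<M} \<times> UNIV \<times> ?N) (range ?L)"
  proof (rule bij_betw_imageI)
    show "F ` ({..<M} \<times> UNIV \<times> ?N) = range ?L"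
    proof (intro equalityI subsetI)
      fix g assume "g \<in> F ` ({..<M} \<times> UNIV \<times> ?N)"
      then obtain i t w where "g = ?L (word i t) \<circ> ?L w"
        using rist_subset by (fastforce simp: F_def)
      then show "g \<in> range ?L"
        by (metis lact_append rangeI)
    next
      fix g assume "g \<in> range ?L"
      then obtain i t n where "n \<in> ?N" "g = ?L (word i t) \<circ> n"
        using normal_form by blast
      then have "g = F (i mod M, t, n)" "(i mod M, t, n) \<in> {..<M} \<times> UNIV \<times> ?N"
        by (simp_all add: F_def L_mod M_pos)
      then show "g \<in> F ` ({..<M} \<times> UNIV \<times> ?N)"
        by blast
    qed
    have dih_cong: "8 * 2 ^ p dvd dih \<phi> u x - dih \<phi> v x" if "?L u = ?L v" for u v x
    proof (rule dih_dvd_if_lact_eq[OF _ _ _ that])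
      show "shift \<omega> i = \<phi>" if "i < p" for i
        using p[of "Suc i"] that by (simp add: shift_def \<phi>_def)
      have "Suc (m - 1) = m"
        using span nz[of 0] by (cases m) auto
      then show "\<phi> \<in> fun_space.span (shift \<omega> ` {p..<m - 1})"
        using span by (simp add: image_shift \<phi>_def)
    qed (simp add: \<phi>_def nz)
    have dih_rist: "8 * 2 ^ p dvd dih \<phi> (sec \<omega> 1 w) x - x"
      if "?L (sec \<omega> 0 w) = id" for w x
    proof -
      \<comment> \<open>The section at \<open>0\<close> is trivial, and \<open>dih_sec_swap\<close>
        transfers this to the section at \<open>1\<close>.\<close>
      have "8 * 2 ^ p dvd dih \<phi> (sec \<omega> 0 w) (1 - x) - (1 - x)"
        using dih_cong[of "sec \<omega> 0 w" "[]"] that by simp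
      moreover have "dih \<phi> (sec \<omega> 1 w) x - x = - (dih \<phi> (sec \<omega> 0 w) (1 - x) - (1 - x))"
        using dih_sec_swap[of \<omega> \<phi> 0 w "1 - x"] by (simp add: \<phi>_def)
      ultimately show ?thesis
        by (simp only: dvd_minus_iff)
    qed
    have dih_word: "dih \<phi> (word i t) x = (if t then - x else x) - 2 * int i" for i t x
      using b(1) by (simp add: word_def dih_append dih_alt)
    show "inj_on F ({..<M} \<times> UNIV \<times> ?N)"
    proof (rule inj_onI)
      fix x y assume mem: "x \<in> {..<M} \<times> UNIV \<times> ?N" "y \<in> {..<M} \<times> UNIV \<times> ?N" and F: "F x = F y"
      obtain i t n j s k where xy: "x = (i, t, n)" "y = (j, s, k)"
        by (metis prod.exhaust)
      with mem F have *: "i < M" "j < M" "n \<in> ?N" "k \<in> ?N" and eq: "F (i, t, n) = F (j, s, k)"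
        by auto
      obtain v w where v: "n = ?L (sec \<omega> 1 v)" "?L (sec \<omega> 0 v) = id"
        and w: "k = ?L (sec \<omega> 1 w)" "?L (sec \<omega> 0 w) = id"
        using * by (auto simp: rist_def)
      have dvd: "8 * 2 ^ p dvd ((if t then - x else x) - 2 * int i) - ((if s then - x else x) - 2 * int j)" for x :: int
      proof -
        have "?L (word i t @ sec \<omega> 1 v) = ?L (word j s @ sec \<omega> 1 w)"
          using eq by (simp add: F_def v w lact_append)
        from dih_cong[OF this, of x]
        have "8 * 2 ^ p dvd dih \<phi> (word i t) (dih \<phi> (sec \<omega> 1 v) x) - dih \<phi> (word j s) (dih \<phi> (sec \<omega> 1 w) x)"
          by (simp add: dih_append)
        from dvd_add[OF dvd_diff[OF this dih_dvd[OF dih_rist[OF v(2), of x], of \<phi> "word i t"]]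
            dih_dvd[OF dih_rist[OF w(2), of x], of \<phi> "word j s"]]
        have "8 * 2 ^ p dvd dih \<phi> (word i t) x - dih \<phi> (word j s) x"
          by simp
        then show ?thesis
          by (simp only: dih_word)
      qed
      \<comment> \<open>Comparing the arguments \<open>1\<close> and \<open>0\<close> isolates the
        slopes; opposite slopes would make the modulus divide 2.\<close>
      have "\<not> 8 * 2 ^ p dvd (2 :: int)" "\<not> 8 * 2 ^ p dvd (- 2 :: int)"
        using dvd_trans[of 8 "8 * 2 ^ p" "2 :: int"] by auto
      then have ts: "t = s"
        using dvd_diff[OF dvd[of 1] dvd[of 0]] by (auto split: if_splits)
      have "2 * int M dvd 2 * (int j - int i)"
        using dvd[of 0] by (cases t; cases s) (simp_all add: M_def algebra_simps)
      then have "int M dvd int j - int i"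
        by (simp only: dvd_mult_cancel_left) simp
      then have "int j mod int M = int i mod int M"
        by (simp only: mod_eq_dvd_iff)
      then have "i = j"
        using * by simp
      moreover have "n = k"
        using eq by (simp add: F_def ts \<open>i = j\<close> lact_left_cancel)
      ultimately show "x = y"
        using ts xy by simp
    qed
  qed
  from bij_betw_same_card[OF this] show ?thesis
    by (simp add: card_cartesian_product M_def)
qed

section \<open>The order of the finite quotients\<close>

lemma funpow_shift: "(shift ^^ j) \<omega> i = \<omega> (i + j)"
  by (induction j arbitrary: i) (simp_all add: shift_def)

lemma image_funpow_shift: "(shift ^^ j) \<omega> ` {i..<k} = \<omega> ` {i + j..<k + j}"
proof -
  have "(shift ^^ j) \<omega> ` {i..<k} = \<omega> ` (\<lambda>x. x + j) ` {i..<k}"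
    unfolding image_image by (rule image_cong) (simp_all add: funpow_shift)
  then show ?thesis
    by (simp only: image_add_atLeastLessThan')
qed

text \<open>
  Modulo level \<open>M + 1\<close> only the first \<open>M\<close> terms of \<open>\<omega>\<close> matter; \<open>M\<close> stays fixed while the depth \<open>j\<close> of
  the section increases.
\<close>

definition lrank :: "(nat \<Rightarrow> 'b \<Rightarrow> bit) \<Rightarrow> nat \<Rightarrow> nat \<Rightarrow> real" where
  "lrank \<omega> M j = log 2 (card (range (lact ((shift ^^ j) \<omega>) (Suc M - j))))"

lemma card_range_lact_pos: "card (range (lact \<omega> m)) > 0"
  by (simp add: card_gt_0_iff finite_range_lact)

context
  fixes \<omega> :: "nat \<Rightarrow> 'b::ab_group_add \<Rightarrow> bit"
  assumes add: "\<And>i. additive (\<omega> i)" and nz: "\<And>i. \<omega> i \<noteq> 0"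
begin

lemma lrank_not_in_span:
  assumes "j \<le> M" "\<omega> j \<notin> fun_space.span (\<omega> ` {Suc j..<M})"
  shows "lrank \<omega> M j = 1 + 2 * lrank \<omega> M (Suc j)"
proof -
  let ?\<omega> = "(shift ^^ j) \<omega>"
  have "?\<omega> ` {1..<M - j} = \<omega> ` {Suc j..<M}"
    using assms(1) by (simp add: image_funpow_shift)
  then have "rist ?\<omega> (M - j) = range (lact (shift ?\<omega>) (M - j))"
    using assms(2) add by (intro rist_eq_range_if_not_in_span) (simp_all add: funpow_shift)
  then have "card (range (lact ?\<omega> (Suc (M - j)))) = 2 * (card (range (lact (shift ?\<omega>) (M - j))))\<^sup>2"
    using card_range_lact_Suc[of ?\<omega> "M - j"] nz[of j] by (simp add: funpow_shift power2_eq_square)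
  then show ?thesis
    using assms(1) card_range_lact_pos[of "shift ?\<omega>" "M - j"]
    by (simp add: lrank_def Suc_diff_le log_mult log_nat_power)
qed

text \<open>Here \<open>rist\<close> has index \<open>2 ^ (p + 3)\<close> in the group of sections,
  so the constant is \<open>1 - (p + 3)\<close>.\<close>

lemma lrank_in_span:
  assumes "j \<le> M" and p: "\<And>i. j \<le> i \<Longrightarrow> i \<le> j + p \<Longrightarrow> \<omega> i = \<omega> j"
    and span: "\<omega> j \<in> fun_space.span (\<omega> ` {Suc (j + p)..<M})"
    and max: "\<omega> (Suc (j + p)) \<noteq> \<omega> j \<or> \<omega> j \<notin> fun_space.span (\<omega> ` {Suc (Suc (j + p))..<M})"
  shows "lrank \<omega> M j = 2 * lrank \<omega> M (Suc j) - (real p + 2)"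
proof -
  let ?\<omega> = "(shift ^^ j) \<omega>"
  let ?c = "card (range (lact (shift ?\<omega>) (M - j)))"
  have img: "?\<omega> ` {Suc i..<M - j} = \<omega> ` {Suc (j + i)..<M}" for i
    using assms(1) by (simp add: image_funpow_shift add.commute)
  have "?c = 8 * 2 ^ p * card (rist ?\<omega> (M - j))"
  proof (rule card_rist_in_span)
    show "?\<omega> i = ?\<omega> 0" if "i \<le> p" for i
      using p[of "i + j"] that by (simp add: funpow_shift)
    show "?\<omega> 0 \<in> fun_space.span (?\<omega> ` {Suc p..<M - j})"
      using span by (simp only: funpow_shift img add_0)
    show "?\<omega> (Suc p) \<noteq> ?\<omega> 0 \<or> ?\<omega> 0 \<notin> fun_space.span (?\<omega> ` {Suc (Suc p)..<M - j})"
      using max by (simp only: funpow_shift img add_0 add_Suc add_Suc_right add.commute[of p])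
  qed (simp_all only: funpow_shift add nz not_False_eq_True)
  then have "2 ^ (p + 3) * card (range (lact ?\<omega> (Suc (M - j)))) = 2 * ?c\<^sup>2"
    using card_range_lact_Suc[of ?\<omega> "M - j"] nz[of j]
    by (simp add: funpow_shift power2_eq_square power_add)
  then have "log 2 (real (2 ^ (p + 3) * card (range (lact ?\<omega> (Suc (M - j)))))) = log 2 (real (2 * ?c\<^sup>2))"
    by (simp only:)
  then show ?thesis
    using assms(1) card_range_lact_pos[of "shift ?\<omega>" "M - j"] card_range_lact_pos[of ?\<omega> "Suc (M - j)"]
    by (simp add: lrank_def Suc_diff_le log_mult log_nat_power)
qed

lemma lrank_end: "lrank \<omega> M M = 1"
proof -
  have "lrank \<omega> M (Suc M) = 0"
    by (simp add: lrank_def)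
  then show ?thesis
    using lrank_not_in_span[of M M] nz[of M] by simp
qed

text \<open>If \<open>\<phi>\<close> is in the span of the later terms, prepending to a run of
  length \<open>q\<close> maps \<open>x\<close> to \<open>2 * x - (q + 2)\<close>, a recursion with
  particular solution \<open>q + 3\<close>. Otherwise the last term of the run follows
  \<open>lrank_not_in_span\<close> and the others have an exponent \<open>p\<close> smaller by one,
  which adds up to \<open>2 * 2 ^ q - 1\<close>.\<close>

lemma lrank_block:
  assumes "q \<le> j" "j \<le> M" and const: "\<And>i. j - q \<le> i \<Longrightarrow> i < j \<Longrightarrow> \<omega> i = \<phi>" and q: "q \<ge> 1"
    and next_block: "j < M \<Longrightarrow> \<omega> j \<noteq> \<phi>"
  shows "lrank \<omega> M (j - q) = 2 ^ q * (lrank \<omega> M j - 3) + q + 3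
    + (if \<phi> \<in> fun_space.span (\<omega> ` {j..<M}) then 0 else 2 * 2 ^ q - 1)"
  using q assms(1) const
proof (induction q rule: dec_induct)
  case base
  then have j: "Suc (j - 1) = j" "\<omega> (j - 1) = \<phi>"
    by auto
  show ?case
  proof (cases "\<phi> \<in> fun_space.span (\<omega> ` {j..<M})")
    case True
    have "j < M"
      using True nz[of "j - 1"] j by (cases "j < M") auto
    then have "lrank \<omega> M (j - 1) = 2 * lrank \<omega> M j - (real 0 + 2)"
      using lrank_in_span[of "j - 1" M 0] j True next_block assms(2) by (auto dest: le_antisym)
    then show ?thesis
      using True by simp
  next
    case False
    then show ?thesis
      using lrank_not_in_span[of "j - 1" M] j assms(2) by simp
  qed
next
  case (step q)
  have j: "Suc (j - Suc q) = j - q" "\<omega> (j - Suc q) = \<phi>"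
    using step.prems by auto
  have IH: "lrank \<omega> M (j - q) = 2 ^ q * (lrank \<omega> M j - 3) + q + 3
    + (if \<phi> \<in> fun_space.span (\<omega> ` {j..<M}) then 0 else 2 * 2 ^ q - 1)"
    using step by simp
  show ?case
  proof (cases "\<phi> \<in> fun_space.span (\<omega> ` {j..<M})")
    case True
    have "j < M"
      using True nz[of "j - Suc q"] j by (cases "j < M") auto
    then have "lrank \<omega> M (j - Suc q) = 2 * lrank \<omega> M (j - q) - (real q + 2)"
      using lrank_in_span[of "j - Suc q" M q] j True next_block assms(2) step.prems by auto
    then show ?thesis
      using True IH by (simp add: algebra_simps)
  next
    case False
    \<comment> \<open>Only the last term of the run puts \<open>\<phi>\<close> into the span, so the
      admissible \<open>p\<close> stops one term earlier.\<close>
    have "\<phi> \<in> \<omega> ` {j - 1..<M}"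
      using step.prems step.hyps assms(2) by (intro image_eqI[of _ _ "j - 1"]) auto
    then have "\<phi> \<in> fun_space.span (\<omega> ` {j - 1..<M})"
      by (rule fun_space.span_base)
    moreover have "Suc (j - Suc q + (q - 1)) = j - 1" "Suc (j - 1) = j"
      using step.hyps step.prems by auto
    ultimately have "lrank \<omega> M (j - Suc q) = 2 * lrank \<omega> M (j - q) - (real (q - 1) + 2)"
      using lrank_in_span[of "j - Suc q" M "q - 1"] j False assms(2) step.prems step.hyps by auto
    then show ?thesis
      using False IH step.hyps by (simp add: algebra_simps of_nat_diff)
  qed
qed

end


section \<open>Syllables\<close>

lemma syl_sum_0 [simp]: "syl_sum a 0 = 0"
  by (simp add: syl_sum_def)

lemma syl_sum_Suc [simp]: "syl_sum a (Suc k) = syl_sum a k + a (Suc k)"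
  by (simp add: syl_sum_def)

lemma Sigma_sum_0 [simp]: "Sigma_sum a 0 = 0"
  by (simp add: Sigma_sum_def)

lemma Sigma_sum_Suc [simp]: "Sigma_sum a (Suc k) = Sigma_sum a k + 2 ^ syl_sum a k * a (Suc k)"
  by (simp add: Sigma_sum_def)

definition fresh :: "(nat \<Rightarrow> 'b \<Rightarrow> bit) \<Rightarrow> nat \<Rightarrow> nat \<Rightarrow> bool" where
  "fresh c k l \<longleftrightarrow> c l \<notin> fun_space.span (c ` {l<..k})"

definition syl_dim :: "(nat \<Rightarrow> 'b \<Rightarrow> bit) \<Rightarrow> nat \<Rightarrow> nat \<Rightarrow> nat" where
  "syl_dim c k l = fun_space.dim (c ` {l<..k})"

lemma dim_insert_bit:
  assumes "finite S"
  shows "fun_space.dim (insert f S) = (if f \<in> fun_space.span S then fun_space.dim S else Suc (fun_space.dim S))"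
proof (cases "f \<in> fun_space.span S")
  case True
  then show ?thesis
    using fun_space.span_redundant[OF True] by (metis fun_space.dim_span)
next
  case False
  obtain B where B: "B \<subseteq> S" "fun_space.independent B" "S \<subseteq> fun_space.span B" "card B = fun_space.dim S"
    using fun_space.basis_exists by blast
  have fin: "finite B"
    using B(1) assms finite_subset by blast
  have span: "fun_space.span B = fun_space.span S"
    using B(1,3) by (metis fun_space.span_eq fun_space.span_superset subset_trans)
  then have "f \<notin> fun_space.span B"
    using False by simp
  then have ind: "fun_space.independent (insert f B)" and "f \<notin> B"
    using B(2) fun_space.span_base by (auto simp: fun_space.independent_insert)
  have "fun_space.span (insert f B) = fun_space.span (insert f S)"
    using span by (simp add: fun_space.span_insert)
  then have "fun_space.dim (insert f S) = card (insert f B)"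
    using fun_space.dim_eq_card[OF _ ind] by (metis fun_space.dim_span)
  then show ?thesis
    using False fin \<open>f \<notin> B\<close> B(4) by simp
qed

lemma dim_mono_bit:
  assumes "finite T" "S \<subseteq> T"
  shows "fun_space.dim S \<le> fun_space.dim T"
proof -
  have "finite S"
    using assms finite_subset by blast
  have "fun_space.dim S \<le> fun_space.dim (U \<union> S)" if "finite U" for U
    using that
  proof induction
    case (insert f U)
    then show ?case
      using dim_insert_bit[of "U \<union> S" f] \<open>finite S\<close> by (simp split: if_splits)
  qed simp
  from this[of T] show ?thesis
    using assms by (simp add: Un_absorb2)
qed

lemma syl_dim_end [simp]: "syl_dim c k k = 0"
  using fun_space.dim_eq_card_independent[OF fun_space.independent_empty] by (simp add: syl_dim_def)

lemma syl_dim_step: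
  assumes "Suc l \<le> k"
  shows "syl_dim c k l = syl_dim c k (Suc l) + (if fresh c k (Suc l) then 1 else 0)"
proof -
  have "{l<..k} = insert (Suc l) {Suc l<..k}"
    using assms by auto
  then show ?thesis
    by (simp add: syl_dim_def fresh_def dim_insert_bit)
qed

lemma syl_dim_antimono: "l \<le> l' \<Longrightarrow> syl_dim c k l' \<le> syl_dim c k l"
  unfolding syl_dim_def by (intro dim_mono_bit) auto

text \<open>Going down from \<open>k\<close>, the dimension starts at 0 and grows by at most one per
  syllable.\<close>

lemma exists_syl_dim:
  assumes "l \<le> k" "i \<le> syl_dim c k l"
  shows "\<exists>l'. l \<le> l' \<and> l' \<le> k \<and> syl_dim c k l' = i"
  using assms
proof (induction l rule: inc_induct)
  case (step l)
  show ?case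
  proof (cases "i \<le> syl_dim c k (Suc l)")
    case True
    then show ?thesis using step.IH by (metis Suc_leD)
  next
    case False
    then have "syl_dim c k l = i"
      using step.prems step.hyps syl_dim_step[of l k c] by (simp split: if_splits)
    then show ?thesis using step.hyps by auto
  qed
qed auto

locale syllables =
  fixes \<omega> c :: "nat \<Rightarrow> 'b::{ab_group_add, finite} \<Rightarrow> bit" and a :: "nat \<Rightarrow> nat"
  assumes additive_\<omega>: "\<And>i. additive (\<omega> i)" and nonzero_\<omega>: "\<And>i. \<omega> i \<noteq> 0"
    and syllable_form: "syllable_form \<omega> c a"
begin

abbreviation s :: "nat \<Rightarrow> nat" where
  "s \<equiv> syl_sum a"

lemma a_pos: "a (Suc k) > 0"
  using syllable_form by (auto simp: syllable_form_def Suc_le_eq)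

lemma c_neq: "k \<ge> 1 \<Longrightarrow> c k \<noteq> c (Suc k)"
  using syllable_form by (simp add: syllable_form_def)

lemma \<omega>_eq: "s k \<le> i \<Longrightarrow> i < s (Suc k) \<Longrightarrow> \<omega> i = c (Suc k)"
  using syllable_form by (simp add: syllable_form_def)

lemma strict_mono_s: "strict_mono s"
  using a_pos by (simp add: strict_mono_Suc_iff)

lemma s_le_iff [simp]: "s k \<le> s l \<longleftrightarrow> k \<le> l"
  using strict_mono_s by (rule strict_mono_less_eq)

lemma le_s: "k \<le> s k"
  using strict_mono_s by (rule strict_mono_imp_increasing)

lemma c_nonzero: "c (Suc k) \<noteq> 0"
  using nonzero_\<omega>[of "s k"] \<omega>_eq[of k "s k"] a_pos[of k] by simp

lemma image_\<omega>:
  assumes "s k < M" "M \<le> s (Suc k)" "l \<le> k"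
  shows "\<omega> ` {s l..<M} = c ` {l<..Suc k}"
proof (intro equalityI subsetI)
  fix f assume "f \<in> \<omega> ` {s l..<M}"
  then obtain i where i: "f = \<omega> i" "s l \<le> i" "i < M"
    by auto
  \<comment> \<open>\<open>Suc j\<close> is the syllable containing position
    \<open>i\<close>.\<close>
  define j where "j = (LEAST j. i < s (Suc j))"
  have ex: "i < s (Suc k)"
    using i assms by simp
  then have j: "i < s (Suc j)" "j \<le> k"
    unfolding j_def by (rule LeastI, rule Least_le)
  have "s j \<le> i"
  proof (cases j)
    case (Suc j')
    then have "\<not> i < s (Suc j')"
      using not_less_Least[of j' "\<lambda>j. i < s (Suc j)"] by (simp add: j_def)
    then show ?thesis
      using Suc by simp
  qed simp
  then have "f = c (Suc j)"
    using i(1) j(1) \<omega>_eq by blast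
  moreover have "s l < s (Suc j)"
    using i(2) j(1) by linarith
  then have "l \<le> j"
    using strict_mono_less[OF strict_mono_s, of l "Suc j"] by simp
  ultimately show "f \<in> c ` {l<..Suc k}"
    using j(2) by auto
next
  fix f assume "f \<in> c ` {l<..Suc k}"
  then obtain j where j: "f = c (Suc j)" "l \<le> j" "j \<le> k"
    by (auto simp: image_iff) (metis Suc_le_D Suc_le_eq Suc_le_mono less_Suc_eq_le)
  then have "f = \<omega> (s j)" "s l \<le> s j" "s j \<le> s k"
    using \<omega>_eq[of j "s j"] a_pos[of j] by (simp_all del: syl_sum_Suc add: syl_sum_Suc[of a j])
  moreover from this(3) assms(1) have "s j < M"
    by (rule le_less_trans)
  ultimately have "s j \<in> {s l..<M}"
    by simp
  then show "f \<in> \<omega> ` {s l..<M}"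
    using \<open>f = \<omega> (s j)\<close> by (simp only: imageI)
qed

lemma image_\<omega>_syl: "l \<le> k \<Longrightarrow> \<omega> ` {s l..<s k} = c ` {l<..k}"
proof (cases k)
  case (Suc k')
  assume "l \<le> k"
  then show ?thesis
    using image_\<omega>[of k' "s k" l] a_pos[of k'] Suc by (cases "l = k") auto
qed auto

text \<open>For \<open>l \<ge> 1\<close> this is \<open>2 ^ s (l - 1) * (2 * 2 ^ a l - 1)\<close>:
  the extra term of an independent run in \<open>lrank_block\<close>, scaled to depth 0.\<close>

definition weight :: "nat \<Rightarrow> real" where
  "weight l = 2 ^ s l * (2 - 1 / 2 ^ a l)"

definition fresh_sum :: "nat \<Rightarrow> nat \<Rightarrow> real" where
  "fresh_sum k l = (\<Sum>i\<in>{i\<in>{1..l}. fresh c k i}. weight i)"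

lemma fresh_sum_Suc:
  "fresh_sum k (Suc l) = fresh_sum k l + (if fresh c k (Suc l) then weight (Suc l) else 0)"
proof -
  have "{i\<in>{1..Suc l}. fresh c k i} =
      (if fresh c k (Suc l) then insert (Suc l) {i\<in>{1..l}. fresh c k i} else {i\<in>{1..l}. fresh c k i})"
    by (auto simp: le_Suc_eq)
  then show ?thesis
    by (simp add: fresh_sum_def)
qed

text \<open>Subtracting 3 and scaling by \<open>2 ^ s l\<close> turns the recursion for one run into
  a telescoping sum.\<close>

lemma lrank_step:
  assumes "s k < M" "M \<le> s (Suc k)" "Suc l \<le> k"
  shows "2 ^ s l * (lrank \<omega> M (s l) - 3) = 2 ^ s (Suc l) * (lrank \<omega> M (s (Suc l)) - 3)
    + 2 ^ s l * a (Suc l) + (if fresh c (Suc k) (Suc l) then weight (Suc l) else 0)"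
proof -
  let ?q = "a (Suc l)"
  have le: "s (Suc l) \<le> s k"
    using assms(3) by (simp only: s_le_iff)
  have "\<omega> i = c (Suc l)" if "s (Suc l) - ?q \<le> i" "i < s (Suc l)" for i
    using \<omega>_eq[of l i] that by simp
  moreover have "\<omega> (s (Suc l)) \<noteq> c (Suc l)"
    using \<omega>_eq[of "Suc l" "s (Suc l)"] a_pos[of "Suc l"] c_neq[of "Suc l"] by simp
  moreover have "(c (Suc l) \<in> fun_space.span (\<omega> ` {s (Suc l)..<M})) = (\<not> fresh c (Suc k) (Suc l))"
    using image_\<omega>[OF assms(1,2,3)] by (simp only: fresh_def not_not)
  ultimately have "lrank \<omega> M (s (Suc l) - ?q) = 2 ^ ?q * (lrank \<omega> M (s (Suc l)) - 3) + ?q + 3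
      + (if \<not> fresh c (Suc k) (Suc l) then 0 else 2 * 2 ^ ?q - 1)"
    using lrank_block[OF additive_\<omega> nonzero_\<omega>, where q = ?q and j = "s (Suc l)" and M = M and \<phi> = "c (Suc l)"] a_pos[of l] le assms(1)
    by simp
  then have eq: "lrank \<omega> M (s l) = 2 ^ ?q * (lrank \<omega> M (s (Suc l)) - 3) + ?q + 3
      + (if \<not> fresh c (Suc k) (Suc l) then 0 else 2 * 2 ^ ?q - 1)"
    by simp
  show ?thesis
    unfolding eq by (simp add: weight_def power_add field_simps)
qed

lemma lrank_eq:
  assumes "s k < M" "M \<le> s (Suc k)"
  shows "lrank \<omega> M 0 = 2 ^ s k * (real (M - s k) - 1) + Sigma_sum a k + fresh_sum (Suc k) k + 3"
proof -
  \<comment> \<open>The syllable cut off at \<open>M\<close> has no visible term after it, so its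
    nonzero functional is outside the zero span.\<close>
  have last: "lrank \<omega> M (s k) = real (M - s k) + 2"
  proof -
    have "lrank \<omega> M (M - (M - s k)) = 2 ^ (M - s k) * (lrank \<omega> M M - 3) + (M - s k) + 3
        + (if c (Suc k) \<in> fun_space.span (\<omega> ` {M..<M}) then 0 else 2 * 2 ^ (M - s k) - 1)"
      using assms \<omega>_eq[of k] by (intro lrank_block additive_\<omega> nonzero_\<omega>) auto
    then show ?thesis
      using assms c_nonzero[of k] by (simp add: lrank_end[OF additive_\<omega> nonzero_\<omega>])
  qed
  have "lrank \<omega> M 0 - 3 = 2 ^ s l * (lrank \<omega> M (s l) - 3) + Sigma_sum a l + fresh_sum (Suc k) l"
    if "l \<le> k" for l
    using that
  proof (induction l)
    case 0
    show ?case by (simp add: fresh_sum_def)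
  next
    case (Suc l)
    then show ?case
      using lrank_step[OF assms Suc.prems] by (simp add: fresh_sum_Suc del: syl_sum_Suc)
  qed
  from this[of k] show ?thesis
    by (simp add: last)
qed

end

section \<open>Monotonicity within a syllable, and the fresh syllables as the
  \<open>\<lambda>\<^sub>i\<close>\<close>

context syllables
begin

lemma fresh_last: "fresh c (Suc (Suc k)) (Suc k)"
proof -
  have "c (Suc k) + c (Suc (Suc k)) \<noteq> 0"
    using c_neq[of "Suc k"] by (fastforce simp: fun_eq_iff)
  moreover have "{Suc k<..Suc (Suc k)} = {Suc (Suc k)}"
    by auto
  ultimately show ?thesis
    using c_nonzero[of k] by (simp add: fresh_def span_insert_bit)
qed

lemma weight_nonneg: "weight l \<ge> 0"
  by (simp add: weight_def field_simps order_trans[OF one_le_power[of "2::real" "a l"]])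

lemma weight_ge: "weight l \<ge> 2 ^ s l"
  by (simp add: weight_def field_simps)

lemma fresh_sum_nonneg: "fresh_sum k l \<ge> 0"
  unfolding fresh_sum_def by (intro sum_nonneg weight_nonneg)

text \<open>Increasing \<open>M\<close> by one doubles the denominator and adds
  \<open>2 ^ s k\<close> to a numerator that is already at least \<open>2 ^ s k\<close>.\<close>

lemma lrank_density_mono:
  assumes "s k < M" "M \<le> s (Suc k)"
  shows "lrank \<omega> (s (Suc k)) 0 / 2 ^ s (Suc k) \<le> lrank \<omega> M 0 / 2 ^ M"
proof -
  define C where "C = Sigma_sum a k + fresh_sum (Suc k) k + 3"
  \<comment> \<open>For \<open>k = 0\<close> the constant 3 suffices; otherwise syllable
    \<open>k\<close> is fresh next to its successor, and its weight suffices.\<close>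
  have "C \<ge> 2 ^ s k"
  proof (cases k)
    case 0
    then show ?thesis
      using fresh_sum_nonneg[of "Suc k" k] by (simp add: C_def)
  next
    case (Suc j)
    have "fresh_sum (Suc k) k \<ge> weight k"
      using fresh_last[of j] fresh_sum_nonneg[of "Suc k" j] by (simp add: Suc fresh_sum_Suc)
    then show ?thesis
      using weight_ge[of k] by (simp add: C_def)
  qed
  have eq: "lrank \<omega> M 0 / 2 ^ M = (2 ^ s k * (real (M - s k) - 1) + C) / 2 ^ M"
    if "s k < M" "M \<le> s (Suc k)" for M
    using lrank_eq[OF that] by (simp add: C_def)
  show ?thesis
    using assms(2,1)
  proof (induction M rule: inc_induct)
    case (step M)
    define X where "X = (2::real) ^ s k * real (M - s k)"
    have "X \<ge> 2 ^ s k * 1"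
      unfolding X_def using step.prems by (intro mult_left_mono) auto
    then have "X + C \<le> 2 * (X - 2 ^ s k + C)"
      using \<open>C \<ge> 2 ^ s k\<close> by simp
    then have "2 ^ s k * real (M - s k) + C \<le> 2 * (2 ^ s k * (real (M - s k) - 1) + C)"
      by (simp add: X_def right_diff_distrib)
    then have "lrank \<omega> (Suc M) 0 / 2 ^ Suc M \<le> lrank \<omega> M 0 / 2 ^ M"
      using step.prems step.hyps eq[of M] eq[of "Suc M"] by (simp add: Suc_diff_le field_simps)
    then show ?case
      using step by simp
  qed simp
qed

lemma lambda_cond_iff: "lambda_cond \<omega> a i k l \<longleftrightarrow> l \<le> k \<and> syl_dim c k l = i"
proof (cases "l \<le> k")
  case True
  then have "(shift ^^ s l) \<omega> ` {0..<s k - s l} = c ` {l<..k}"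
    unfolding image_funpow_shift using image_\<omega>_syl[OF True] True by simp
  then show ?thesis
    using True by (simp add: lambda_cond_def dim_mod_def syl_dim_def Suc_diff_le atLeast0LessThan)
qed (simp add: lambda_cond_def)

text \<open>The dimension drops at a fresh syllable, so every smaller index has a strictly larger
  dimension.\<close>

lemma lambda_idx_eq:
  assumes "Suc l \<le> k" "fresh c k (Suc l)"
  shows "lambda_idx \<omega> a (syl_dim c k (Suc l)) k = Suc l"
  unfolding lambda_idx_def
proof (rule Least_equality)
  fix l' assume "lambda_cond \<omega> a (syl_dim c k (Suc l)) k l'"
  then have "syl_dim c k l' < syl_dim c k l"
    using syl_dim_step[OF assms(1), of c] assms(2) by (simp add: lambda_cond_iff)
  then show "Suc l \<le> l'"
    using syl_dim_antimono[of l' l c k] by (cases "l' \<le> l") auto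
qed (simp add: lambda_cond_iff assms(1))

lemma syl_dim_last: "syl_dim c (Suc (Suc k)) (Suc k) = 1" "syl_dim c (Suc (Suc k)) k = 2"
proof -
  have "{Suc k<..Suc (Suc k)} = {Suc (Suc k)}"
    by auto
  then have "fresh c (Suc (Suc k)) (Suc (Suc k))"
    using c_nonzero[of "Suc k"] by (simp add: fresh_def)
  then show "syl_dim c (Suc (Suc k)) (Suc k) = 1"
    using syl_dim_step[of "Suc k" "Suc (Suc k)" c] by simp
  then show "syl_dim c (Suc (Suc k)) k = 2"
    using syl_dim_step[of k "Suc (Suc k)" c] fresh_last[of k] by simp
qed

text \<open>Fresh syllables are the jumps of \<open>syl_dim\<close>, which makes
  \<open>lambda_idx\<close> and \<open>syl_dim\<close> mutually inverse here. The last two syllables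
  have dimensions 1 and 0, so the range starts at 2.\<close>

lemma fresh_sum_lambda:
  assumes "n \<le> syl_dim c (Suc (Suc k)) 0"
  shows "(\<Sum>i=2..n - 1. weight (lambda_idx \<omega> a i (Suc (Suc k)))) =
    (\<Sum>l\<in>{l\<in>{1..k}. fresh c (Suc (Suc k)) l \<and> syl_dim c (Suc (Suc k)) l < n}. weight l)"
proof (rule sum.reindex_bij_witness[where i = "syl_dim c (Suc (Suc k))" and
      j = "\<lambda>i. lambda_idx \<omega> a i (Suc (Suc k))"])
  let ?K = "Suc (Suc k)"
  let ?A = "{l\<in>{1..k}. fresh c ?K l \<and> syl_dim c ?K l < n}"
  fix i assume i: "i \<in> {2..n - 1}"
  have "\<exists>l. lambda_cond \<omega> a i ?K l"
    using exists_syl_dim[of 0 ?K i c] i assms by (auto simp: lambda_cond_iff)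
  from LeastI_ex[OF this] have l: "lambda_idx \<omega> a i ?K \<le> ?K" "syl_dim c ?K (lambda_idx \<omega> a i ?K) = i"
    by (auto simp: lambda_idx_def lambda_cond_iff)
  show "syl_dim c ?K (lambda_idx \<omega> a i ?K) = i"
    by fact
  have "lambda_idx \<omega> a i ?K \<noteq> 0"
    using l i assms by (intro notI) auto
  then obtain l' where l': "lambda_idx \<omega> a i ?K = Suc l'"
    by (metis not0_implies_Suc)
  have "lambda_idx \<omega> a i ?K \<noteq> Suc k" "lambda_idx \<omega> a i ?K \<noteq> ?K"
    using l i syl_dim_last[of k] by (auto intro!: notI)
  then have "lambda_idx \<omega> a i ?K \<le> k"
    using l(1) by linarith
  \<comment> \<open>By minimality the dimension changes between \<open>l'\<close> and
    \<open>Suc l'\<close>, which is freshness.\<close>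
  moreover have "\<not> lambda_cond \<omega> a i ?K l'"
    using not_less_Least[of l' "lambda_cond \<omega> a i ?K"] l' by (simp add: lambda_idx_def)
  then have "fresh c ?K (Suc l')"
    using syl_dim_step[of l' ?K c] l l' by (simp add: lambda_cond_iff split: if_splits)
  ultimately show "lambda_idx \<omega> a i ?K \<in> ?A"
    using l i l' by auto
next
  let ?K = "Suc (Suc k)"
  fix l assume l: "l \<in> {l\<in>{1..k}. fresh c ?K l \<and> syl_dim c ?K l < n}"
  then obtain l' where l': "l = Suc l'"
    by (cases l) auto
  then show "lambda_idx \<omega> a (syl_dim c ?K l) ?K = l"
    using lambda_idx_eq[of l' ?K] l by simp
  show "syl_dim c ?K l \<in> {2..n - 1}"
    using l syl_dim_antimono[of l k c ?K] syl_dim_last(2)[of k] by auto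
qed simp

end

lemma additive_if_dual: "\<phi> \<in> dual \<Longrightarrow> additive \<phi>"
  unfolding dual_def mem_Collect_eq
proof -
  assume "Vector_Spaces.linear (*s) (*) \<phi>"
  then interpret Vector_Spaces.linear "(*s)" "(*)" \<phi> .
  show "additive \<phi>"
    by (simp add: additive_def add)
qed

section \<open>The lower dimension and the bounded error\<close>

context syllables
begin

definition tail_dim :: "nat \<Rightarrow> nat" where
  "tail_dim j = fun_space.dim (\<omega> ` {j..})"

text \<open>There are only finitely many functions on the finite type, so finitely many positions
  already give all terms of the tail.\<close>

lemma eventually_image_eq: "eventually (\<lambda>m. \<omega> ` {j..<m} = \<omega> ` {j..}) sequentially"
proof -
  have "finite (\<omega> ` {j..})"
    by (rule finite)
  then obtain C where C: "C \<subseteq> {j..}" "finite C" "\<omega> ` {j..} = \<omega> ` C"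
    by (metis finite_subset_image order_refl)
  obtain N where N: "\<And>i. i \<in> C \<Longrightarrow> i < N"
    using C(2) finite_nat_set_iff_bounded by auto
  have "\<omega> ` {j..<m} = \<omega> ` {j..}" if "m \<ge> N" for m
  proof
    have "C \<subseteq> {j..<m}"
      using C(1) order_less_le_trans[OF N that] by auto
    then show "\<omega> ` {j..} \<subseteq> \<omega> ` {j..<m}"
      unfolding C(3) by (rule image_mono)
  qed (intro image_mono, auto)
  then show ?thesis
    by (auto simp: eventually_sequentially)
qed

lemma lim_dim_mod: "lim (dim_mod ((shift ^^ j) \<omega>)) = tail_dim j"
proof -
  obtain N where N: "\<And>m. m \<ge> N \<Longrightarrow> \<omega> ` {j..<m} = \<omega> ` {j..}"
    using eventually_image_eq[of j] unfolding eventually_sequentially by metis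
  have "eventually (\<lambda>m. dim_mod ((shift ^^ j) \<omega>) m = tail_dim j) sequentially"
  proof (rule eventually_sequentiallyI[of "Suc N"])
    fix m assume "Suc N \<le> m"
    then have "\<omega> ` {j..<m - 1 + j} = \<omega> ` {j..}"
      by (intro N) simp
    then have "(shift ^^ j) \<omega> ` {0..<m - 1} = \<omega> ` {j..}"
      unfolding image_funpow_shift by simp
    then show "dim_mod ((shift ^^ j) \<omega>) m = tail_dim j"
      by (simp add: dim_mod_def tail_dim_def atLeast0LessThan)
  qed
  from limI[OF tendsto_eventually[OF this]] show ?thesis .
qed

lemma tail_dim_antimono: "i \<le> j \<Longrightarrow> tail_dim j \<le> tail_dim i"
  unfolding tail_dim_def by (intro dim_mono_bit image_mono) auto

text \<open>A non-increasing sequence of natural numbers is constant from its minimum on.\<close>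

lemma tail_dim_eventually_lower_dim: "\<exists>J. \<forall>j\<ge>J. enat (tail_dim j) = lower_dim \<omega>"
proof -
  obtain J where J: "\<And>j. tail_dim J \<le> tail_dim j"
    using ex_has_least_nat[of "\<lambda>_. True" _ tail_dim] by blast
  then have const: "tail_dim j = tail_dim J" if "j \<ge> J" for j
    using tail_dim_antimono[OF that] by (simp add: le_antisym)
  then have "eventually (\<lambda>j. enat (tail_dim j) = enat (tail_dim J)) sequentially"
    unfolding eventually_sequentially by metis
  from lim_imp_Liminf[OF trivial_limit_sequentially tendsto_eventually[OF this]]
  have "lower_dim \<omega> = enat (tail_dim J)"
    by (simp add: lower_dim_def lim_dim_mod)
  then show ?thesis
    using const by metis
qed

lemma syl_dim_le_tail_dim:
  assumes "l \<le> k"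
  shows "syl_dim c k l \<le> tail_dim (s l)"
  unfolding syl_dim_def tail_dim_def image_\<omega>_syl[OF assms, symmetric]
  by (intro dim_mono_bit image_mono) auto

lemma eventually_tail_dim_le_syl_dim: "eventually (\<lambda>k. tail_dim 0 \<le> syl_dim c k 0) sequentially"
proof -
  have "filterlim s sequentially sequentially"
    using strict_mono_s by (rule filterlim_subseq)
  from eventually_compose_filterlim[OF eventually_image_eq this, of 0] show ?thesis
  proof (rule eventually_mono)
    fix k assume "\<omega> ` {0..<s k} = \<omega> ` {0..}"
    then show "tail_dim 0 \<le> syl_dim c k 0"
      using image_\<omega>_syl[of 0 k] by (simp add: tail_dim_def syl_dim_def)
  qed
qed

definition lambda_sum :: "nat \<Rightarrow> nat \<Rightarrow> real" where
  "lambda_sum n k = (\<Sum>i=2..n - 1. weight (lambda_idx \<omega> a i k))"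

text \<open>
  Besides those of the \<open>\<lambda>\<^sub>i\<close>, only the weights of boundedly many syllables contribute: a fresh
  syllable raises the dimension of the span, and from some index on this dimension is at most \<open>n\<close>.
\<close>

lemma fresh_sum_bounds:
  assumes "lower_dim \<omega> = enat n"
  obtains W where
    "eventually (\<lambda>k. n \<le> syl_dim c k 0) sequentially"
    "\<And>k. n \<le> syl_dim c (Suc (Suc k)) 0 \<Longrightarrow> lambda_sum n (Suc (Suc k)) \<le> fresh_sum (Suc (Suc k)) k"
    "\<And>k. n \<le> syl_dim c (Suc (Suc k)) 0 \<Longrightarrow> fresh_sum (Suc (Suc k)) k \<le> lambda_sum n (Suc (Suc k)) + W"
proof -
  obtain J where J: "\<And>j. j \<ge> J \<Longrightarrow> tail_dim j = n"
    using tail_dim_eventually_lower_dim assms by auto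
  define W where "W = (\<Sum>l=1..J. weight l)"
  have "n \<le> tail_dim 0"
    using tail_dim_antimono[of 0 J] J by simp
  then have ev: "eventually (\<lambda>k. n \<le> syl_dim c k 0) sequentially"
    using eventually_tail_dim_le_syl_dim by (auto elim: eventually_mono)
  have bounds: "lambda_sum n (Suc (Suc k)) \<le> fresh_sum (Suc (Suc k)) k \<and>
      fresh_sum (Suc (Suc k)) k \<le> lambda_sum n (Suc (Suc k)) + W"
    if n: "n \<le> syl_dim c (Suc (Suc k)) 0" for k
  proof -
    let ?K = "Suc (Suc k)"
    let ?A = "{l\<in>{1..k}. fresh c ?K l}"
    have "fresh_sum ?K k = (\<Sum>l\<in>?A \<inter> {l. syl_dim c ?K l < n}. weight l) + (\<Sum>l\<in>?A \<inter> - {l. syl_dim c ?K l < n}. weight l)"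
      unfolding fresh_sum_def by (rule sum.Int_Diff[unfolded Diff_eq]) simp
    also have "?A \<inter> {l. syl_dim c ?K l < n} = {l\<in>{1..k}. fresh c ?K l \<and> syl_dim c ?K l < n}"
      by auto
    also have "sum weight \<dots> = lambda_sum n ?K"
      using fresh_sum_lambda[OF n] by (simp add: lambda_sum_def)
    finally have split: "fresh_sum ?K k = lambda_sum n ?K + (\<Sum>l\<in>?A \<inter> - {l. syl_dim c ?K l < n}. weight l)" .
    have "?A \<inter> - {l. syl_dim c ?K l < n} \<subseteq> {1..J}"
    proof
      fix l assume l: "l \<in> ?A \<inter> - {l. syl_dim c ?K l < n}"
      then obtain l' where l': "l = Suc l'"
        by (cases l) auto
      then have "n < syl_dim c ?K l'"
        using l syl_dim_step[of l' ?K c] by auto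
      also have "\<dots> \<le> tail_dim (s l')"
        using l l' by (intro syl_dim_le_tail_dim) auto
      finally have "\<not> J \<le> s l'"
        using J by auto
      then show "l \<in> {1..J}"
        using l' le_s[of l'] by auto
    qed
    then have "(\<Sum>l\<in>?A \<inter> - {l. syl_dim c ?K l < n}. weight l) \<le> W"
      unfolding W_def by (intro sum_mono2) (auto simp: weight_nonneg)
    moreover have "(\<Sum>l\<in>?A \<inter> - {l. syl_dim c ?K l < n}. weight l) \<ge> 0"
      by (intro sum_nonneg weight_nonneg)
    ultimately show ?thesis
      using split by linarith
  qed
  show ?thesis
    using that[OF ev] bounds by blast
qed

definition level_term :: "nat \<Rightarrow> nat \<Rightarrow> real" where
  "level_term n k = Sigma_sum a k / 2 ^ s k + 1 / 2 ^ s k * lambda_sum n k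
    + 1 / 2 ^ a k * (1 - 1 / 2 ^ a (k - 1))"

text \<open>The last syllable is complete and completes \<open>Sigma_sum\<close>. The one before it
  is always fresh; its weight minus \<open>2 ^ s (Suc k)\<close> gives the final summand of
  \<open>level_term\<close>.\<close>

lemma lrank_syllable_end:
  "lrank \<omega> (s (Suc (Suc k))) 0 / 2 ^ s (Suc (Suc k)) = level_term n (Suc (Suc k))
    + (fresh_sum (Suc (Suc k)) k - lambda_sum n (Suc (Suc k)) + 3) / 2 ^ s (Suc (Suc k))"
proof -
  have "lrank \<omega> (s (Suc (Suc k))) 0 = 2 ^ s (Suc k) * (real (a (Suc (Suc k))) - 1)
      + Sigma_sum a (Suc k) + (fresh_sum (Suc (Suc k)) k + weight (Suc k)) + 3"
    using lrank_eq[of "Suc k" "s (Suc (Suc k))"] a_pos[of "Suc k"] fresh_last[of k]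
    by (simp add: fresh_sum_Suc)
  then have "lrank \<omega> (s (Suc (Suc k))) 0 = Sigma_sum a (Suc (Suc k)) + fresh_sum (Suc (Suc k)) k + 3
      + 2 ^ s (Suc k) * (1 - 1 / 2 ^ a (Suc k))"
    by (simp add: weight_def algebra_simps)
  moreover have "(2::real) ^ s (Suc k) * x / 2 ^ s (Suc (Suc k)) = 1 / 2 ^ a (Suc (Suc k)) * x" for x
    by (simp add: power_add)
  ultimately show ?thesis
    by (simp add: level_term_def add_divide_distrib diff_divide_distrib)
qed

text \<open>The error is nonnegative and at most a constant over \<open>2 ^ s k\<close>:
  \<open>W\<close> bounds the surplus fresh weights, and 3 comes from
  \<open>lrank_eq\<close>.\<close>

lemma lrank_syllable_end_asymp:
  assumes "lower_dim \<omega> = enat n"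
  shows "(\<lambda>k. lrank \<omega> (s k) 0 / 2 ^ s k - level_term n k) \<longlonglongrightarrow> 0"
proof -
  obtain W where ev: "eventually (\<lambda>k. n \<le> syl_dim c k 0) sequentially"
    and W: "\<And>k. n \<le> syl_dim c (Suc (Suc k)) 0 \<Longrightarrow> lambda_sum n (Suc (Suc k)) \<le> fresh_sum (Suc (Suc k)) k"
      "\<And>k. n \<le> syl_dim c (Suc (Suc k)) 0 \<Longrightarrow> fresh_sum (Suc (Suc k)) k \<le> lambda_sum n (Suc (Suc k)) + W"
    using fresh_sum_bounds[OF assms] by blast
  have lim: "(\<lambda>k. (W + 3) / 2 ^ s k) \<longlonglongrightarrow> 0"
  proof -
    have "(\<lambda>k. (W + 3) * (1 / 2) ^ k) \<longlonglongrightarrow> (W + 3) * 0"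
      by (intro tendsto_mult_left LIMSEQ_realpow_zero) auto
    from LIMSEQ_subseq_LIMSEQ[OF this strict_mono_s] show ?thesis
      by (simp add: o_def power_one_over field_simps)
  qed
  have bounds: "0 \<le> lrank \<omega> (s k) 0 / 2 ^ s k - level_term n k \<and>
      lrank \<omega> (s k) 0 / 2 ^ s k - level_term n k \<le> (W + 3) / 2 ^ s k"
    if "k \<ge> 2" "n \<le> syl_dim c k 0" for k
  proof -
    from that(1) have "k = Suc (Suc (k - 2))"
      by simp
    then obtain k' where k: "k = Suc (Suc k')" ..
    have "lrank \<omega> (s k) 0 / 2 ^ s k - level_term n k = (fresh_sum k k' - lambda_sum n k + 3) / 2 ^ s k"
      unfolding k by (simp only: lrank_syllable_end[of k' n] add_diff_cancel_left')
    moreover have "0 \<le> fresh_sum k k' - lambda_sum n k + 3" "fresh_sum k k' - lambda_sum n k + 3 \<le> W + 3"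
      using W[of k'] that(2) by (simp_all add: k)
    ultimately show ?thesis
      by (auto intro: divide_right_mono)
  qed
  have ev': "eventually (\<lambda>k. k \<ge> 2 \<and> n \<le> syl_dim c k 0) sequentially"
    using ev eventually_ge_at_top[of "2::nat"] by eventually_elim auto
  show ?thesis
    by (rule tendsto_sandwich[OF _ _ tendsto_const lim])
      (use bounds in \<open>auto intro!: eventually_mono[OF ev']\<close>)
qed

section \<open>The limes inferior of the densities\<close>

definition density :: "nat \<Rightarrow> real" where
  "density m = log 2 (card (range (lact \<omega> m))) / 2 ^ m"

lemma density_Suc: "density (Suc M) = lrank \<omega> M 0 / 2 ^ M / 2"
  by (simp add: density_def lrank_def)

text \<open>Syllable ends form a subsequence, which gives one inequality. Conversely, the density at
  any large level is at least that at the end of the syllable it falls into.\<close>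

lemma liminf_density:
  "liminf (\<lambda>m. ereal (density m)) = liminf (\<lambda>k. ereal (density (Suc (s k))))"
proof (rule antisym)
  have "strict_mono (\<lambda>k. Suc (s k))"
    using strict_mono_s by (simp add: strict_mono_def)
  from liminf_subseq_mono[OF this, of "\<lambda>m. ereal (density m)"]
  show "liminf (\<lambda>m. ereal (density m)) \<le> liminf (\<lambda>k. ereal (density (Suc (s k))))"
    by (simp add: o_def)
  show "liminf (\<lambda>k. ereal (density (Suc (s k)))) \<le> liminf (\<lambda>m. ereal (density m))"
    unfolding le_Liminf_iff
  proof (intro allI impI)
    fix y assume "y < liminf (\<lambda>k. ereal (density (Suc (s k))))"
    from less_LiminfD[OF this] obtain K where K: "\<And>k. k \<ge> K \<Longrightarrow> y < ereal (density (Suc (s k)))"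
      unfolding eventually_sequentially by metis
    have "y < ereal (density m)" if "m \<ge> Suc (Suc (s K))" for m
    proof -
      define M where "M = m - 1"
      then have m: "m = Suc M" "s K < M"
        using that by auto
      \<comment> \<open>\<open>Suc k\<close> is the syllable of the last term visible modulo level
        \<open>m = Suc M\<close>.\<close>
      define k where "k = (LEAST k. M \<le> s (Suc k))"
      have "M \<le> s (Suc M)"
        using le_s[of "Suc M"] by linarith
      then have k: "M \<le> s (Suc k)"
        unfolding k_def by (rule LeastI)
      have "s K < s (Suc k)"
        using m(2) k by linarith
      then have "K \<le> k"
        using strict_mono_less[OF strict_mono_s, of K "Suc k"] by simp
      have "s k < M"
      proof (cases k)
        case (Suc k')
        then have "\<not> M \<le> s (Suc k')"
          using not_less_Least[of k' "\<lambda>k. M \<le> s (Suc k)"] by (simp add: k_def)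
        then show ?thesis
          using Suc by simp
      qed (use m in auto)
      from lrank_density_mono[OF this k] have "density (Suc (s (Suc k))) \<le> density m"
        by (simp add: density_Suc m)
      moreover have "y < ereal (density (Suc (s (Suc k))))"
        using K[of "Suc k"] \<open>K \<le> k\<close> by simp
      ultimately show ?thesis
        by (metis ereal_less_eq(3) less_le_trans)
    qed
    then show "eventually (\<lambda>m. y < ereal (density m)) sequentially"
      unfolding eventually_sequentially by metis
  qed
qed

text \<open>Adding a null sequence does not change the limes inferior; the factor one half is the
  shift from \<open>M\<close> visible terms to level \<open>Suc M\<close>.\<close>

lemma liminf_density_eq:
  assumes "lower_dim \<omega> = enat n"
  shows "liminf (\<lambda>m. ereal (density m)) = ereal (1 / 2) * liminf (\<lambda>k. ereal (level_term n k))"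
proof -
  define err where "err k = lrank \<omega> (s k) 0 / 2 ^ s k - level_term n k" for k
  have "err \<longlonglongrightarrow> 0"
    unfolding err_def using lrank_syllable_end_asymp[OF assms] .
  then have "(\<lambda>k. ereal (err k)) \<longlonglongrightarrow> ereal 0"
    by (rule tendsto_ereal)
  from ereal_liminf_lim_add[OF this, of "\<lambda>k. ereal (level_term n k)"]
  have "liminf (\<lambda>k. ereal (err k) + ereal (level_term n k)) = liminf (\<lambda>k. ereal (level_term n k))"
    by simp
  moreover have "ereal (density (Suc (s k))) = ereal (1 / 2) * (ereal (err k) + ereal (level_term n k))" for k
    by (simp add: density_Suc err_def)
  ultimately show ?thesis
    by (simp only: liminf_density Liminf_ereal_mult_left[OF trivial_limit_sequentially] zero_le_divide_1_iff zero_le_numeral)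
qed

end

theorem theorem4p4:
  fixes \<omega> c :: "nat \<Rightarrow> (bit ^ 'd \<Rightarrow> bit)" and a :: "nat \<Rightarrow> nat" and n :: nat
  assumes "\<omega> \<in> Omega"
    and "syllable_form \<omega> c a"
    and "lower_dim \<omega> = enat n"
    and "n \<ge> 2"
  shows "(\<forall>\<^sub>F k in sequentially. \<forall>i\<in>{2..n - 1}. \<exists>l. lambda_cond \<omega> a i k l) \<and>
    hausdorff_dim (spinal_group \<omega>) =
      ereal (1 / 2) * liminf (\<lambda>k. ereal (
          real (Sigma_sum a k) / 2 ^ syl_sum a k
        + 1 / 2 ^ syl_sum a k *
            (\<Sum>i=2..n - 1. 2 ^ syl_sum a (lambda_idx \<omega> a i k) *
                            (2 - 1 / 2 ^ a (lambda_idx \<omega> a i k)))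
        + 1 / 2 ^ a k * (1 - 1 / 2 ^ a (k - 1))))"
proof -
  interpret syllables \<omega> c a
  proof (rule syllables.intro)
    show "additive (\<omega> i)" for i
      using assms(1) by (intro additive_if_dual) (simp add: Omega_def)
    show "\<omega> i \<noteq> 0" for i
      using assms(1) by (simp add: Omega_def zero_fun_def)
  qed fact
  have "eventually (\<lambda>k. n \<le> syl_dim c k 0) sequentially"
    using fresh_sum_bounds[OF assms(3)] by blast
  then have "\<forall>\<^sub>F k in sequentially. \<forall>i\<in>{2..n - 1}. \<exists>l. lambda_cond \<omega> a i k l"
  proof (rule eventually_mono)
    fix k assume "n \<le> syl_dim c k 0"
    then show "\<forall>i\<in>{2..n - 1}. \<exists>l. lambda_cond \<omega> a i k l"
      using exists_syl_dim[of 0 k _ c] by (auto simp: lambda_cond_iff)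
  qed
  moreover have "hausdorff_dim (spinal_group \<omega>) = liminf (\<lambda>m. ereal (density m))"
    by (simp add: hausdorff_dim_def order_quot_mod density_def)
  ultimately show ?thesis
    using liminf_density_eq[OF assms(3)]
    by (simp add: level_term_def lambda_sum_def weight_def)
qed

end
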